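(* Let $\alpha(H)\in K[H]$ be a polynomial of degree $d\geq 1$ in the variable $H=YX$. The centralizer in $A_1$ of the element $u=\alpha(YX)X\in A_1$ is the polynomial ring $K[u]$, and $$I_k=u^{k-\left[\frac{k}{d+1}\right]}\,K[u]\quad\text{for all } k\geq 1 .$$ In particular, $I_1=uK[u]$ and $I_{i(d+1)-1}=I_{i(d+1)}=u^{id}K[u]$ for all $i\geq 1$. Hence $I_1I_{i(d+1)-1}\neq I_{i(d+1)}$ for all $i\geq 1$; and so Dixmier's Problem 5 (for $u\in A_1$ an element of nilpotent type, is $I_{n+1}=I_1I_n$ for all sufficiently large $n$?) has a negative answer.
   Context: $K$ is a field of characteristic zero. The first Weyl algebra $A_1$ is the associative $K$-algebra generated by $X$ and $Y$ subject to the defining relation $YX-XY=1$; put $H=YX\in A_1$ and regard $K[H]$ as a (polynomial) subalgebra of $A_1$. For a non-scalar element $u\in A_1$, let $\mathrm{ad}\,u$ be the inner derivation $(\mathrm{ad}\,u)(a)=ua-au$ of $A_1$; let $N(u,i)=\ker(\mathrm{ad}\,u)^{i+1}$ for $i\ge 0$, and $N(u)=\bigcup_{i\geq 0}N(u,i)$. The centralizer of $u$ is $C(u)=\ker \mathrm{ad}\,u=N(u,0)$. The element $u$ is said to be of nilpotent type if $C(u)\neq N(u)$. For $n\geq 0$ set $I_n=(\mathrm{ad}\,u)^nN(u,n)$; this is an ideal of the commutative algebra $C(u)$. For natural numbers $n$ and $m\neq 0$, $\left[\frac{n}{m}\right]$ denotes the integer quotient, i.e. the natural number $l$ with $n=lm+r$,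 $0\leq r<m$. *)

theory Defs
  imports "HOL-Computational_Algebra.Polynomial" "HOL-Library.Poly_Mapping"
begin

section \<open>The first Weyl algebra\<close>

datatype weyl_gen = GX | GY

text \<open>
  The free monoid on the two generators, written additively (\<open>+\<close> is concatenation): the convolution
  product on finitely supported functions \<open>weyl_word \<Rightarrow>\<^sub>0 'k\<close> is then that of the free
  associative algebra on \<open>X\<close> and \<open>Y\<close>.
\<close>

datatype weyl_word = Word (letters: "weyl_gen list")

instantiation weyl_word :: monoid_add
begin

definition zero_weyl_word :: weyl_word
  where "0 = Word []"

definition plus_weyl_word :: "weyl_word \<Rightarrow> weyl_word \<Rightarrow> weyl_word"
  where "v + w = Word (letters v @ letters w)"

instance
  by standard (auto simp: zero_weyl_word_def plus_weyl_word_def)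

end

type_synonym 'k free_alg = "weyl_word \<Rightarrow>\<^sub>0 'k"

definition free_gen :: "weyl_gen \<Rightarrow> 'k::field free_alg"
  where "free_gen g = Poly_Mapping.single (Word [g]) 1"

text \<open>The two-sided ideal of the free algebra generated by \<open>YX - XY - 1\<close>.\<close>

inductive_set weyl_ideal :: "'k::field free_alg set" where
  rel: "free_gen GY * free_gen GX - free_gen GX * free_gen GY - 1 \<in> weyl_ideal"
| zero: "0 \<in> weyl_ideal"
| add: "a \<in> weyl_ideal \<Longrightarrow> b \<in> weyl_ideal \<Longrightarrow> a + b \<in> weyl_ideal"
| mult_left: "a \<in> weyl_ideal \<Longrightarrow> r * a \<in> weyl_ideal"
| mult_right: "a \<in> weyl_ideal \<Longrightarrow> a * r \<in> weyl_ideal"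

lemma weyl_ideal_uminus: "a \<in> weyl_ideal \<Longrightarrow> - a \<in> weyl_ideal"
  using weyl_ideal.mult_left[of a "- 1"] by simp

lemma weyl_ideal_diff: "a \<in> weyl_ideal \<Longrightarrow> b \<in> weyl_ideal \<Longrightarrow> a - b \<in> weyl_ideal"
  using weyl_ideal.add[of a "- b"] weyl_ideal_uminus[of b] by simp

definition weyl_rel :: "'k::field free_alg \<Rightarrow> 'k free_alg \<Rightarrow> bool"
  where "weyl_rel a b \<longleftrightarrow> a - b \<in> weyl_ideal"

lemma equivp_weyl_rel: "equivp weyl_rel"
proof (rule equivpI)
  show "reflp weyl_rel"
    by (simp add: reflp_def weyl_rel_def weyl_ideal.zero)
  show "symp weyl_rel"
    using weyl_ideal_uminus by (force simp: symp_def weyl_rel_def)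
  show "transp weyl_rel"
    using weyl_ideal.add by (force simp: transp_def weyl_rel_def)
qed

subsection \<open>The ideal is proper\<close>

text \<open>
  The free algebra acts on \<open>'k poly\<close>, with \<open>X\<close> acting as multiplication by the variable and \<open>Y\<close> as
  the derivative. The ideal acts as zero, hence does not contain \<open>1\<close>; this is needed for the
  quotient to be an instance of \<^class>\<open>ring_1\<close>.
\<close>

fun gen_act :: "weyl_gen \<Rightarrow> 'k::field poly \<Rightarrow> 'k poly" where
  "gen_act GX p = pCons 0 p"
| "gen_act GY p = pderiv p"

definition word_act :: "weyl_word \<Rightarrow> 'k::field poly \<Rightarrow> 'k poly"
  where "word_act w = foldr gen_act (letters w)"

definition free_act :: "'k::field free_alg \<Rightarrow> 'k poly \<Rightarrow> 'k poly"
  where "free_act f p =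
    (\<Sum>w\<in>Poly_Mapping.keys f. smult (Poly_Mapping.lookup f w) (word_act w p))"

lemma
  fixes p q :: "'a::field poly"
  shows word_act_0 [simp]: "word_act w (0 :: 'a poly) = 0"
  and word_act_add: "word_act w (p + q) = word_act w p + word_act w q"
  and word_act_smult: "word_act w (smult c p) = smult c (word_act w p)"
proof -
  have 1: "gen_act g 0 = (0 :: 'a poly)"
    and 2: "gen_act g (p + q) = gen_act g p + gen_act g q"
    and 3: "gen_act g (smult c p) = smult c (gen_act g p)" for g and c :: 'a and p q :: "'a poly"
    by (cases g; simp add: pderiv_add pderiv_smult)+
  have "foldr gen_act l 0 = (0 :: 'a poly)"
    and "foldr gen_act l (p + q) = foldr gen_act l p + foldr gen_act l q"
    and "foldr gen_act l (smult c p) = smult c (foldr gen_act l p)" for l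
    by (induction l) (simp_all add: 1 2 3)
  then show "word_act w 0 = (0 :: 'a poly)"
    and "word_act w (p + q) = word_act w p + word_act w q"
    and "word_act w (smult c p) = smult c (word_act w p)"
    by (simp_all add: word_act_def)
qed

lemma word_act_plus: "word_act (v + w) p = word_act v (word_act w p)"
  by (simp add: word_act_def plus_weyl_word_def)

lemma free_act_superset:
  assumes "finite S" "Poly_Mapping.keys f \<subseteq> S"
  shows "free_act f p = (\<Sum>w\<in>S. smult (Poly_Mapping.lookup f w) (word_act w p))"
  unfolding free_act_def
  by (rule sum.mono_neutral_left) (use assms in \<open>auto simp: in_keys_iff\<close>)

lemma free_act_add: "free_act (f + g) p = free_act f p + free_act g p"
proof -
  let ?S = "Poly_Mapping.keys f \<union> Poly_Mapping.keys g"
  have "Poly_Mapping.keys (f + g) \<subseteq> ?S"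
    by (rule Poly_Mapping.keys_add)
  then show ?thesis
    by (simp add: free_act_superset[of ?S] lookup_add smult_add_left sum.distrib)
qed

lemma free_act_0 [simp]: "free_act 0 p = 0"
  by (simp add: free_act_def)

lemma free_act_single: "free_act (Poly_Mapping.single w c) p = smult c (word_act w p)"
  by (simp add: free_act_superset[of "{w}"])

lemma free_act_1 [simp]: "free_act 1 p = p"
  unfolding single_one[symmetric] free_act_single by (simp add: word_act_def zero_weyl_word_def)

lemma free_act_diff: "free_act (f - g) p = free_act f p - free_act g p"
  using free_act_add[of "f - g" g p] by simp

lemma free_act_0_right [simp]: "free_act f 0 = 0"
  by (simp add: free_act_def)

lemma free_act_add_right: "free_act f (p + q) = free_act f p + free_act f q"
  by (simp add: free_act_def word_act_add smult_add_right sum.distrib)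

lemma free_alg_induct [case_names single add]:
  fixes f :: "'k::field free_alg"
  assumes single: "\<And>w c. P (Poly_Mapping.single w c)"
    and add: "\<And>f g. P f \<Longrightarrow> P g \<Longrightarrow> P (f + g)"
  shows "P f"
proof (induction f rule: update_induct)
  case const
  then show ?case
    using single[of 0 0] by simp
next
  case (update f a b)
  have "Poly_Mapping.update a b f = f + Poly_Mapping.single a b"
    using update.hyps
    by (intro poly_mapping_eqI)
      (auto simp: lookup_update lookup_add lookup_single when_def in_keys_iff)
  then show ?case
    using update.IH single add by simp
qed

lemma free_act_mult: "free_act (f * g) p = free_act f (free_act g p)"
proof (induction f rule: free_alg_induct)
  case (single v c)
  show ?case
    by (induction g rule: free_alg_induct)
      (simp_all add: mult_single free_act_single word_act_plus word_act_smult
        distrib_left free_act_add word_act_add smult_add_right)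
next
  case (add f1 f2)
  then show ?case
    by (simp add: distrib_right free_act_add)
qed

lemma free_act_weyl_ideal: "a \<in> weyl_ideal \<Longrightarrow> free_act a p = 0"
proof (induction a arbitrary: p rule: weyl_ideal.induct)
  case rel
  show ?case
    by (simp add: free_act_diff free_act_mult free_gen_def free_act_single word_act_def pderiv_pCons)
qed (simp_all add: free_act_add free_act_mult)

lemma one_notin_weyl_ideal: "1 \<notin> weyl_ideal"
  using free_act_weyl_ideal[of 1 1] by auto

subsection \<open>The quotient algebra\<close>

quotient_type (overloaded) 'k weyl = "'k::field free_alg" / weyl_rel
  by (rule equivp_weyl_rel)

instantiation weyl :: (field) ring_1
begin

lift_definition zero_weyl :: "'a weyl" is 0 .

lift_definition one_weyl :: "'a weyl" is 1 .

lift_definition plus_weyl :: "'a weyl \<Rightarrow> 'a weyl \<Rightarrow> 'a weyl" is "(+)"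
  unfolding weyl_rel_def using weyl_ideal.add by (force simp: algebra_simps)

lift_definition uminus_weyl :: "'a weyl \<Rightarrow> 'a weyl" is uminus
  unfolding weyl_rel_def using weyl_ideal_uminus by force

lift_definition minus_weyl :: "'a weyl \<Rightarrow> 'a weyl \<Rightarrow> 'a weyl" is "(-)"
  unfolding weyl_rel_def using weyl_ideal_diff by (force simp: algebra_simps)

lift_definition times_weyl :: "'a weyl \<Rightarrow> 'a weyl \<Rightarrow> 'a weyl" is "(*)"
proof -
  fix a b c d :: "'a free_alg"
  assume "weyl_rel a b" "weyl_rel c d"
  moreover have "a * c - b * d = a * (c - d) + (a - b) * d"
    by (simp add: algebra_simps)
  ultimately show "weyl_rel (a * c) (b * d)"
    unfolding weyl_rel_def
    by (simp add: weyl_ideal.add weyl_ideal.mult_left weyl_ideal.mult_right)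
qed

instance
proof
  show "(0 :: 'a weyl) \<noteq> 1"
    by transfer (use weyl_ideal_uminus one_notin_weyl_ideal in \<open>force simp: weyl_rel_def\<close>)
qed (transfer; simp add: weyl_rel_def algebra_simps weyl_ideal.zero)+

end

lift_definition weyl_X :: "'k::field weyl" is "free_gen GX" .

lift_definition weyl_Y :: "'k::field weyl" is "free_gen GY" .

lift_definition weyl_const :: "'k::field \<Rightarrow> 'k weyl" is "Poly_Mapping.single 0" .

lemma weyl_relation: "weyl_Y * weyl_X - weyl_X * weyl_Y = (1 :: 'k::field weyl)"
  by transfer (simp add: weyl_rel_def weyl_ideal.rel)

lemma weyl_const_commute: "weyl_const c * a = a * weyl_const c"
proof transfer
  fix c :: 'a and a :: "'a free_alg"
  have "Poly_Mapping.single 0 c * a = a * Poly_Mapping.single 0 c"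
    by (induction a rule: free_alg_induct) (simp_all add: mult_single mult.commute algebra_simps)
  then show "weyl_rel (Poly_Mapping.single 0 c * a) (a * Poly_Mapping.single 0 c)"
    by (simp add: weyl_rel_def weyl_ideal.zero)
qed

text \<open>The library's \<^const>\<open>poly\<close> evaluates in commutative semirings only.\<close>

definition weyl_poly :: "'k::field poly \<Rightarrow> 'k weyl \<Rightarrow> 'k weyl"
  where "weyl_poly p a = (\<Sum>i\<le>degree p. weyl_const (coeff p i) * a ^ i)"

definition gen_subalg :: "'k::field weyl \<Rightarrow> 'k weyl set"
  where "gen_subalg u = range (\<lambda>p. weyl_poly p u)"

section \<open>Inner derivations\<close>

definition ad :: "'a::ring \<Rightarrow> 'a \<Rightarrow> 'a"
  where "ad u a = u * a - a * u"

definition ad_ker :: "'a::ring \<Rightarrow> nat \<Rightarrow> 'a set"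
  where "ad_ker u i = {a. (ad u ^^ (i + 1)) a = 0}"

definition ad_nil :: "'a::ring \<Rightarrow> 'a set"
  where "ad_nil u = (\<Union>i. ad_ker u i)"

definition centralizer :: "'a::ring \<Rightarrow> 'a set"
  where "centralizer u = {a. ad u a = 0}"

definition nilpotent_type :: "'k::field weyl \<Rightarrow> bool"
  where "nilpotent_type u \<longleftrightarrow> u \<notin> range weyl_const \<and> centralizer u \<noteq> ad_nil u"

definition ad_ideal :: "'a::ring \<Rightarrow> nat \<Rightarrow> 'a set"
  where "ad_ideal u n = (ad u ^^ n) ` ad_ker u n"

text \<open>The product of ideals: all finite sums of products.\<close>

definition ideal_mult :: "'a::ring set \<Rightarrow> 'a set \<Rightarrow> 'a set"
  where "ideal_mult A B =
    {\<Sum>j<m. f j * g j |(m :: nat) f g. (\<forall>j<m. f j \<in> A) \<and> (\<forall>j<m. g j \<in> B)}"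

text \<open>The affirmative answer to Dixmier's Problem 5 for the Weyl algebra over \<open>'k\<close>.\<close>

definition dixmier_problem_5 :: "'k::field itself \<Rightarrow> bool"
  where "dixmier_problem_5 _ \<longleftrightarrow>
    (\<forall>u :: 'k weyl. nilpotent_type u \<longrightarrow>
      (\<forall>\<^sub>F n in sequentially. ad_ideal u (n + 1) = ideal_mult (ad_ideal u 1) (ad_ideal u n)))"

end

theory Submission
  imports Defs
begin

text \<open>
  In the skew Laurent ring \<open>K(H)[X, X\<inverse>]\<close>, where \<open>X f(H) = f(H - 1) X\<close> and \<open>Y = H X\<inverse>\<close>, every element
  is a sum of terms \<open>g(H) u\<^sup>n\<close>, and \<open>ad u\<close> maps \<open>g(H) u\<^sup>n\<close> to \<open>(g(H - 1) - g(H)) u\<^sup>n\<^sup>+\<^sup>1\<close>. So \<open>N(u, k)\<close>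
  consists of the elements of \<open>A\<^sub>1\<close> whose coefficients \<open>g\<close> are polynomials of degree at most \<open>k\<close>, and
  \<open>(ad u)\<^sup>k\<close> only sees their coefficients of \<open>H\<^sup>k\<close>. For \<open>n = -m < 0\<close>, membership in \<open>A\<^sub>1\<close> means that
  \<open>g\<close> is divisible by the polynomial \<open>u\<^sup>m Y\<^sup>m\<close> in \<open>H\<close>, which has degree \<open>m(d + 1)\<close>; hence exactly the
  \<open>m \<le> k div (d + 1)\<close> occur. Rational functions are avoided by multiplying with a large power of \<open>u\<close>
  on the left.
\<close>

section \<open>Generalities on the Weyl algebra\<close>

lemma weyl_const_0 [simp]: "weyl_const 0 = 0"
  by transfer (simp add: weyl_rel_def weyl_ideal.zero)

lemma weyl_const_1 [simp]: "weyl_const 1 = 1"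
  by transfer (simp add: weyl_rel_def weyl_ideal.zero)

lemma weyl_const_add: "weyl_const (a + b) = weyl_const a + weyl_const b"
  by transfer (simp add: weyl_rel_def weyl_ideal.zero single_add)

lemma weyl_const_mult: "weyl_const (a * b) = weyl_const a * weyl_const b"
  by transfer (simp add: weyl_rel_def weyl_ideal.zero mult_single)

lemma weyl_const_minus: "weyl_const (- a) = - weyl_const a"
  by transfer (simp add: weyl_rel_def weyl_ideal.zero single_uminus)

lemma weyl_const_of_nat: "weyl_const (of_nat n) = of_nat n"
  by (induction n) (simp_all add: weyl_const_add)

text \<open>A class in the quotient is represented by a sum of scaled words, and a word grows by
  prepending letters.\<close>

lemma weyl_gen_induct [case_names const X Y add]:
  fixes a :: "'k::field weyl"
  assumes const: "\<And>c. P (weyl_const c)"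
    and X: "\<And>a. P a \<Longrightarrow> P (weyl_X * a)"
    and Y: "\<And>a. P a \<Longrightarrow> P (weyl_Y * a)"
    and add: "\<And>a b. P a \<Longrightarrow> P b \<Longrightarrow> P (a + b)"
  shows "P a"
proof -
  have "P (abs_weyl f)" for f :: "'k free_alg"
  proof (induction f rule: free_alg_induct)
    case (single w c)
    have "P (abs_weyl (Poly_Mapping.single (Word l) c))" for l
    proof (induction l)
      case Nil
      show ?case
        using const[of c] by (simp add: weyl_const.abs_eq zero_weyl_word_def)
    next
      case (Cons g l)
      have "Poly_Mapping.single (Word (g # l)) c = free_gen g * Poly_Mapping.single (Word l) c"
        by (simp add: free_gen_def mult_single plus_weyl_word_def)
      then have "abs_weyl (Poly_Mapping.single (Word (g # l)) c) =
          abs_weyl (free_gen g) * abs_weyl (Poly_Mapping.single (Word l) c)"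
        by (simp add: times_weyl.abs_eq)
      then show ?case
        using X[OF Cons.IH] Y[OF Cons.IH] by (cases g) (simp_all add: weyl_X_def weyl_Y_def)
    qed
    from this[of "letters w"] show ?case
      by simp
  next
    case (add f g)
    then show ?case
      using assms(4)[of "abs_weyl f" "abs_weyl g"] by (simp add: plus_weyl.abs_eq)
  qed
  then show ?thesis
    by (metis Quotient3_abs_rep Quotient3_weyl)
qed

subsection \<open>Polynomials in an element\<close>

lemma weyl_poly_superset:
  assumes "degree p \<le> n"
  shows "weyl_poly p a = (\<Sum>i\<le>n. weyl_const (coeff p i) * a ^ i)"
  unfolding weyl_poly_def
  by (rule sum.mono_neutral_left) (use assms in \<open>auto simp: coeff_eq_0\<close>)

lemma weyl_poly_0 [simp]: "weyl_poly 0 a = 0"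
  by (simp add: weyl_poly_def)

lemma weyl_poly_pCons: "weyl_poly (pCons c p) a = weyl_const c + a * weyl_poly p a"
proof -
  have "weyl_poly (pCons c p) a
      = (\<Sum>i\<le>Suc (degree p). weyl_const (coeff (pCons c p) i) * a ^ i)"
    by (rule weyl_poly_superset) (simp add: degree_pCons_le)
  also have "\<dots> = weyl_const c + (\<Sum>i\<le>degree p. weyl_const (coeff p i) * a ^ Suc i)"
    unfolding sum.atMost_Suc_shift by simp
  also have "(\<Sum>i\<le>degree p. weyl_const (coeff p i) * a ^ Suc i) = a * weyl_poly p a"
    unfolding weyl_poly_def sum_distrib_left
    by (rule sum.cong) (auto simp: mult.assoc[symmetric] weyl_const_commute[of _ a])
  finally show ?thesis .
qed

lemma weyl_poly_add: "weyl_poly (p + q) a = weyl_poly p a + weyl_poly q a"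
  by (induction p q rule: poly_induct2) (simp_all add: weyl_poly_pCons weyl_const_add algebra_simps)

lemma weyl_poly_minus: "weyl_poly (- p) a = - weyl_poly p a"
  using weyl_poly_add[of p "- p" a] by (simp add: eq_neg_iff_add_eq_0 add.commute)

lemma weyl_poly_diff: "weyl_poly (p - q) a = weyl_poly p a - weyl_poly q a"
  using weyl_poly_add[of p "- q" a] by (simp add: weyl_poly_minus)

lemma weyl_poly_sum: "weyl_poly (\<Sum>i\<in>A. f i) a = (\<Sum>i\<in>A. weyl_poly (f i) a)"
  by (induction A rule: infinite_finite_induct) (simp_all add: weyl_poly_add)

lemma weyl_poly_const: "weyl_poly [:c:] a = weyl_const c"
  by (simp add: weyl_poly_pCons)

lemma weyl_poly_1 [simp]: "weyl_poly 1 a = 1"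
  unfolding one_pCons weyl_poly_const by simp

lemma weyl_poly_smult: "weyl_poly (smult c p) a = weyl_const c * weyl_poly p a"
proof (induction p)
  case (pCons b p)
  have "a * (weyl_const c * weyl_poly p a) = weyl_const c * (a * weyl_poly p a)"
    by (metis mult.assoc weyl_const_commute)
  with pCons show ?case
    by (simp add: weyl_poly_pCons weyl_const_mult distrib_left)
qed simp

lemma weyl_poly_mult: "weyl_poly (p * q) a = weyl_poly p a * weyl_poly q a"
  by (induction p) (simp_all add: weyl_poly_pCons weyl_poly_add weyl_poly_smult algebra_simps)

lemma weyl_poly_monom: "weyl_poly (monom c n) a = weyl_const c * a ^ n"
  by (induction n) (simp_all add: monom_0 monom_Suc weyl_poly_pCons
      mult.assoc[symmetric] weyl_const_commute[of _ a])

lemma weyl_poly_commute: "weyl_poly p a * weyl_poly q a = weyl_poly q a * weyl_poly p a"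
  by (metis mult.commute weyl_poly_mult)

lemma weyl_poly_commute_power: "weyl_poly p a * a ^ n = a ^ n * weyl_poly p a"
  using weyl_poly_commute[of p a "monom 1 n"] by (simp add: weyl_poly_monom)

subsection \<open>Shifts\<close>

abbreviation weyl_H :: "'k::field weyl"
  where "weyl_H \<equiv> weyl_Y * weyl_X"

text \<open>The automorphism of K[H] by which X^n passes a polynomial in H.\<close>

definition shift :: "nat \<Rightarrow> 'k::field poly \<Rightarrow> 'k poly"
  where "shift n f = pcompose f [:- of_nat n, 1:]"

lemma shift_0 [simp]: "shift n 0 = 0"
  by (simp add: shift_def)

lemma shift_zero [simp]: "shift 0 f = f"
  by (simp add: shift_def)

lemma shift_pCons: "shift n (pCons c f) = [:c:] + [:- of_nat n, 1:] * shift n f"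
  by (simp add: shift_def pcompose_pCons)

lemma shift_add: "shift n (f + g) = shift n f + shift n g"
  by (simp add: shift_def pcompose_add)

lemma shift_prod: "shift n (\<Prod>i\<in>A. f i) = (\<Prod>i\<in>A. shift n (f i))"
  by (simp add: shift_def pcompose_prod)

lemma degree_shift [simp]: "degree (shift n f) = degree f"
  by (simp add: shift_def degree_pcompose)

lemma shift_eq_0_iff [simp]: "shift n f = 0 \<longleftrightarrow> f = 0"
  by (simp add: shift_def pcompose_eq_0_iff)

lemma shift_shift: "shift m (shift n f) = shift (m + n) f"
  by (simp add: shift_def pcompose_assoc[symmetric] pcompose_pCons algebra_simps)

lemma poly_shift: "poly (shift n f) x = poly f (x - of_nat n)"
  by (simp add: shift_def poly_pcompose)

text \<open>Stated for any \<open>v\<close> with this rule, since both X and later \<open>u\<close>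
  satisfy it. Each factor \<open>v\<close> that passes H lowers it by 1.\<close>

lemma skew_power_commute:
  fixes v :: "'k::field weyl"
  assumes v: "v * weyl_H = (weyl_H - 1) * v"
  shows "v ^ n * weyl_poly f weyl_H = weyl_poly (shift n f) weyl_H * v ^ n"
proof -
  have 1: "v ^ n * weyl_H = (weyl_H - of_nat n) * v ^ n"
  proof (induction n)
    case (Suc n)
    have "v ^ Suc n * weyl_H = v * (weyl_H - of_nat n) * v ^ n"
      by (simp add: mult.assoc Suc.IH)
    also have "v * (weyl_H - of_nat n) = v * weyl_H - of_nat n * v"
      by (simp add: algebra_simps mult_of_nat_commute)
    also have "\<dots> = (weyl_H - of_nat (Suc n)) * v"
      by (simp add: v algebra_simps)
    finally show ?case
      by (simp add: mult.assoc)
  qed simp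
  show ?thesis
  proof (induction f)
    case (pCons c f)
    have "v ^ n * weyl_poly (pCons c f) weyl_H
        = weyl_const c * v ^ n + (v ^ n * weyl_H) * weyl_poly f weyl_H"
      by (simp add: weyl_poly_pCons distrib_left weyl_const_commute mult.assoc)
    also have "(v ^ n * weyl_H) * weyl_poly f weyl_H
        = (weyl_H - of_nat n) * weyl_poly (shift n f) weyl_H * v ^ n"
      unfolding 1 by (simp add: mult.assoc pCons.IH)
    also have "weyl_const c * v ^ n + (weyl_H - of_nat n) * weyl_poly (shift n f) weyl_H * v ^ n
        = weyl_poly (shift n (pCons c f)) weyl_H * v ^ n"
      unfolding shift_pCons weyl_poly_add weyl_poly_mult weyl_poly_const distrib_right
      by (simp add: weyl_poly_pCons weyl_const_minus weyl_const_of_nat)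
    finally show ?case .
  qed simp
qed

section \<open>Commutation of X and Y with polynomials in H\<close>

lemma weyl_XY: "weyl_X * weyl_Y = weyl_H - 1"
  using weyl_relation by (metis add_diff_cancel_left' diff_add_cancel)

lemma weyl_X_H: "weyl_X * weyl_H = (weyl_H - 1) * weyl_X"
  by (simp add: weyl_XY mult.assoc[symmetric])

lemma weyl_H_Y: "weyl_Y * weyl_H = (weyl_H + 1) * weyl_Y"
proof -
  have "weyl_H * weyl_Y = weyl_Y * (weyl_H - 1)"
    by (simp add: weyl_XY mult.assoc)
  also have "\<dots> = weyl_Y * weyl_H - weyl_Y"
    by (simp add: right_diff_distrib)
  finally have "weyl_H * weyl_Y = weyl_Y * weyl_H - weyl_Y" .
  then show ?thesis
    unfolding distrib_right \<open>weyl_H * weyl_Y = weyl_Y * weyl_H - weyl_Y\<close> by simp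
qed

lemmas weyl_X_power_commute = skew_power_commute[OF weyl_X_H]

lemma weyl_X_commute: "weyl_X * weyl_poly f weyl_H = weyl_poly (shift 1 f) weyl_H * weyl_X"
  using weyl_X_power_commute[of 1 f] by simp

text \<open>Passing Y raises the argument to H + 1, against the direction of \<open>shift\<close>;
  hence the explicit \<open>pcompose\<close>.\<close>

lemma weyl_Y_commute:
  "weyl_Y * weyl_poly f weyl_H = weyl_poly (pcompose f [:1, 1:]) weyl_H * weyl_Y"
proof (induction f)
  case (pCons c f)
  have "weyl_Y * weyl_poly (pCons c f) weyl_H
      = weyl_const c * weyl_Y + (weyl_Y * weyl_H) * weyl_poly f weyl_H"
    by (simp add: weyl_poly_pCons distrib_left weyl_const_commute mult.assoc)
  also have "(weyl_Y * weyl_H) * weyl_poly f weyl_H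
      = (weyl_H + 1) * weyl_poly (pcompose f [:1, 1:]) weyl_H * weyl_Y"
    unfolding weyl_H_Y by (simp add: mult.assoc pCons.IH)
  finally show ?case
    by (simp add: pcompose_pCons weyl_poly_pCons weyl_poly_add weyl_poly_smult algebra_simps)
qed simp

text \<open>Moving X or Y past f(H) and absorbing it by XY = H - 1 or YX = H keeps terms f(H) X^n
  and f(H) Y^n in this form, so sums of such terms exhaust A_1.\<close>

lemma weyl_induct [case_names X Y add]:
  fixes a :: "'k::field weyl"
  assumes X: "\<And>f n. P (weyl_poly f weyl_H * weyl_X ^ n)"
    and Y: "\<And>f n. P (weyl_poly f weyl_H * weyl_Y ^ n)"
    and add: "\<And>a b. P a \<Longrightarrow> P b \<Longrightarrow> P (a + b)"
  shows "P a"
proof -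
  \<comment> \<open>\<open>P\<close> itself need not survive left multiplication by X or Y.
    Membership in every \<open>A\<close> of \<open>S\<close> does, because \<open>S\<close> is
    closed under preimages of these multiplications.\<close>
  define S :: "'k weyl set set" where "S = {A. (\<forall>f n. weyl_poly f weyl_H * weyl_X ^ n \<in> A)
    \<and> (\<forall>f n. weyl_poly f weyl_H * weyl_Y ^ n \<in> A) \<and> (\<forall>a\<in>A. \<forall>b\<in>A. a + b \<in> A)}"
  have S: "{a. weyl_X * a \<in> A} \<in> S" "{a. weyl_Y * a \<in> A} \<in> S" if A: "A \<in> S" for A
  proof -
    have AX: "weyl_poly f weyl_H * weyl_X ^ n \<in> A"
      and AY: "weyl_poly f weyl_H * weyl_Y ^ n \<in> A" for f n
      using A by (auto simp: S_def)
    have 1: "weyl_X * (weyl_poly f weyl_H * weyl_X ^ n) \<in> A" for f n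
    proof -
      have "weyl_X * (weyl_poly f weyl_H * weyl_X ^ n)
          = weyl_poly (shift 1 f) weyl_H * weyl_X ^ Suc n"
        by (simp add: mult.assoc[symmetric] weyl_X_commute)
      then show ?thesis
        by (simp only: AX AY)
    qed
    have 2: "weyl_X * (weyl_poly f weyl_H * weyl_Y ^ n) \<in> A" for f n
    proof (cases n)
      case 0
      then show ?thesis
        using 1[of f 0] by simp
    next
      case (Suc m)
      have "weyl_X * (weyl_poly f weyl_H * weyl_Y ^ n)
          = weyl_poly (shift 1 f) weyl_H * (weyl_X * weyl_Y) * weyl_Y ^ m"
        by (simp add: Suc mult.assoc[symmetric] weyl_X_commute)
      also have "\<dots> = weyl_poly (shift 1 f * [:-1, 1:]) weyl_H * weyl_Y ^ m"
        unfolding weyl_XY weyl_poly_mult by (simp add: weyl_poly_pCons weyl_const_minus)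
      finally show ?thesis
        by (simp only: AX AY)
    qed
    have 3: "weyl_Y * (weyl_poly f weyl_H * weyl_Y ^ n) \<in> A" for f n
    proof -
      have "weyl_Y * (weyl_poly f weyl_H * weyl_Y ^ n)
          = weyl_poly (pcompose f [:1, 1:]) weyl_H * weyl_Y ^ Suc n"
        by (simp add: mult.assoc[symmetric] weyl_Y_commute)
      then show ?thesis
        by (simp only: AX AY)
    qed
    have 4: "weyl_Y * (weyl_poly f weyl_H * weyl_X ^ n) \<in> A" for f n
    proof (cases n)
      case 0
      then show ?thesis
        using 3[of f 0] by simp
    next
      case (Suc m)
      have "weyl_Y * (weyl_poly f weyl_H * weyl_X ^ n)
          = weyl_poly (pcompose f [:1, 1:]) weyl_H * weyl_H * weyl_X ^ m"
        by (simp add: Suc mult.assoc[symmetric] weyl_Y_commute)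
      also have "\<dots> = weyl_poly (pcompose f [:1, 1:] * [:0, 1:]) weyl_H * weyl_X ^ m"
        unfolding weyl_poly_mult by (simp add: weyl_poly_pCons)
      finally show ?thesis
        by (simp only: AX AY)
    qed
    show "{a. weyl_X * a \<in> A} \<in> S" "{a. weyl_Y * a \<in> A} \<in> S"
      unfolding S_def mem_Collect_eq using 1 2 3 4 A by (simp_all add: S_def distrib_left)
  qed
  have "\<forall>A\<in>S. a \<in> A"
  proof (induction a rule: weyl_gen_induct)
    case (const c)
    show ?case
    proof
      fix A assume "A \<in> S"
      then have "weyl_poly [:c:] weyl_H * weyl_X ^ 0 \<in> A"
        unfolding S_def mem_Collect_eq by (elim conjE allE) assumption
      then show "weyl_const c \<in> A"
        by (simp add: weyl_poly_const)
    qed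
  next
    case (X a)
    show ?case
    proof
      fix A assume "A \<in> S"
      from bspec[OF X S(1)[OF this]] show "weyl_X * a \<in> A"
        by simp
    qed
  next
    case (Y a)
    show ?case
    proof
      fix A assume "A \<in> S"
      from bspec[OF Y S(2)[OF this]] show "weyl_Y * a \<in> A"
        by simp
    qed
  next
    case (add a b)
    show ?case
    proof
      fix A assume A: "A \<in> S"
      with add have "a \<in> A" "b \<in> A"
        by simp_all
      with A show "a + b \<in> A"
        by (simp add: S_def)
    qed
  qed
  moreover have "{a. P a} \<in> S"
    unfolding S_def mem_Collect_eq by (intro conjI allI ballI X Y) (simp add: add)
  ultimately have "a \<in> {a. P a}"
    by (rule bspec)
  then show ?thesis
    by simp
qed

section \<open>Cancellation of integers and of X on the right\<close>

lemma weyl_of_nat_cancel: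
  fixes a :: "'k::field_char_0 weyl"
  assumes "of_nat n * a = 0" "n > 0"
  shows "a = 0"
proof -
  have "a = weyl_const (1 / of_nat n) * (weyl_const (of_nat n) * a)"
    using \<open>n > 0\<close> by (simp add: mult.assoc[symmetric] weyl_const_mult[symmetric])
  then show ?thesis
    using assms by (simp add: weyl_const_of_nat)
qed

text \<open>The derivation \<open>ad Y\<close> is locally nilpotent and sends \<open>X\<close> to \<open>1\<close>; applying a suitable power
  of it to \<open>a * X\<close> isolates a nonzero multiple of the last nonvanishing derivative of \<open>a\<close>.\<close>

lemma weyl_X_cancel_right:
  fixes a :: "'k::field_char_0 weyl"
  assumes "a * weyl_X = 0"
  shows "a = 0"
proof -
  define D :: "'k weyl \<Rightarrow> 'k weyl" where "D = ad weyl_Y"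
  have D_0: "D 0 = 0"
    by (simp add: D_def ad_def)
  have D_add: "D (a + b) = D a + D b" for a b
    by (simp add: D_def ad_def algebra_simps)
  have D_mult: "D (a * b) = D a * b + a * D b" for a b
    by (simp add: D_def ad_def algebra_simps)
  have Dn_0: "(D ^^ n) 0 = 0" for n
    by (induction n) (simp_all add: D_0)
  have Dn_add: "(D ^^ n) (a + b) = (D ^^ n) a + (D ^^ n) b" for n a b
    by (induction n) (simp_all add: D_add)
  have DX: "D weyl_X = 1"
    using weyl_relation by (simp add: D_def ad_def)
  have D_of_nat: "D (of_nat m * b) = of_nat m * D b" for m b
    by (induction m) (simp_all add: D_0 D_add distrib_right)
  \<comment> \<open>Since D X = 1 and D 1 = 0, the higher Leibniz rule has only two terms.\<close>
  have Dn_X_right: "(D ^^ Suc n) (a * weyl_X)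
      = (D ^^ Suc n) a * weyl_X + of_nat (Suc n) * (D ^^ n) a" for n a
    by (induction n)
      (simp_all add: D_mult[of _ weyl_X] DX D_add D_of_nat distrib_right add.assoc del: of_nat_Suc, simp_all add: distrib_right add_ac)
  have Dn_X_left: "(D ^^ Suc n) (weyl_X * a)
      = weyl_X * (D ^^ Suc n) a + of_nat (Suc n) * (D ^^ n) a" for n a
    by (induction n)
      (simp_all add: D_mult[of weyl_X] DX D_add D_of_nat distrib_right add_ac del: of_nat_Suc, simp_all add: distrib_right add_ac)
  have nilpotent: "\<exists>n. (D ^^ n) a = 0" for a
  proof (induction a rule: weyl_gen_induct)
    case (const c)
    have "(D ^^ 1) (weyl_const c) = 0"
      by (simp add: D_def ad_def weyl_const_commute)
    then show ?case by blast
  next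
    case (X a)
    then obtain n where "(D ^^ n) a = 0" by blast
    then have "(D ^^ Suc n) (weyl_X * a) = 0"
      unfolding Dn_X_left by (simp add: D_0)
    then show ?case by blast
  next
    case (Y a)
    have "(D ^^ n) (weyl_Y * a) = weyl_Y * (D ^^ n) a" for n
      by (induction n) (simp_all add: D_def ad_def algebra_simps)
    with Y show ?case
      by (metis mult_zero_right)
  next
    case (add a b)
    then obtain m n where mn: "(D ^^ m) a = 0" "(D ^^ n) b = 0" by blast
    have "(D ^^ (n + m)) a = 0" "(D ^^ (m + n)) b = 0"
      unfolding funpow_add by (simp_all add: mn Dn_0)
    then show ?case
      by (intro exI[of _ "m + n"]) (simp add: Dn_add add.commute)
  qed
  have "(D ^^ n) a = 0 \<Longrightarrow> a = 0" for n
  proof (induction n)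
    case (Suc n)
    have "of_nat (Suc n) * (D ^^ n) a = 0"
      using Dn_X_right[of n a] unfolding assms Dn_0 Suc.prems by simp
    then show ?case
      using Suc.IH weyl_of_nat_cancel[of "Suc n"] by blast
  qed simp
  then show ?thesis
    using nilpotent[of a] by blast
qed

lemma weyl_X_power_cancel_right:
  fixes a :: "'k::field_char_0 weyl"
  shows "a * weyl_X ^ n = 0 \<Longrightarrow> a = 0"
  by (induction n) (auto simp: power_Suc2 mult.assoc[symmetric] simp del: power_Suc
      dest: weyl_X_cancel_right)

subsection \<open>Skew polynomials\<close>

text \<open>The double polynomial only stores the sequence of left coefficients; its commutative
  product does not correspond to the product of A_1.\<close>

definition wsum :: "'k::field poly poly \<Rightarrow> 'k weyl \<Rightarrow> 'k weyl"
  where "wsum F v = (\<Sum>n\<le>degree F. weyl_poly (coeff F n) weyl_H * v ^ n)"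

lemma wsum_superset:
  assumes "degree F \<le> N"
  shows "wsum F v = (\<Sum>n\<le>N. weyl_poly (coeff F n) weyl_H * v ^ n)"
  unfolding wsum_def
  by (rule sum.mono_neutral_left) (use assms in \<open>auto simp: coeff_eq_0\<close>)

lemma wsum_0 [simp]: "wsum 0 v = 0"
  by (simp add: wsum_def)

lemma wsum_add: "wsum (F + G) v = wsum F v + wsum G v"
proof -
  let ?N = "max (degree F) (degree G)"
  show ?thesis
    by (simp add: wsum_superset[of _ ?N] degree_add_le_max weyl_poly_add distrib_right sum.distrib)
qed

lemma wsum_minus: "wsum (- F) v = - wsum F v"
  using wsum_add[of F "- F" v] by (simp add: eq_neg_iff_add_eq_0 add.commute)

lemma wsum_diff: "wsum (F - G) v = wsum F v - wsum G v"
  using wsum_add[of F "- G" v] by (simp add: wsum_minus)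

lemma wsum_monom: "wsum (monom f n) v = weyl_poly f weyl_H * v ^ n"
proof -
  have "wsum (monom f n) v = (\<Sum>i\<le>n. weyl_poly (coeff (monom f n) i) weyl_H * v ^ i)"
    by (rule wsum_superset) (simp add: degree_monom_le)
  also have "\<dots> = weyl_poly (coeff (monom f n) n) weyl_H * v ^ n"
    by (rule sum.remove[of _ n, THEN trans]) (auto intro!: sum.neutral)
  finally show ?thesis by simp
qed

text \<open>As coefficients stand on the left, \<open>v\<close> on the right raises exponents
  without any commutation rule.\<close>

lemma wsum_pCons: "wsum (pCons f F) v = weyl_poly f weyl_H + wsum F v * v"
proof -
  have "wsum (pCons f F) v
      = (\<Sum>n\<le>Suc (degree F). weyl_poly (coeff (pCons f F) n) weyl_H * v ^ n)"
    by (rule wsum_superset) (simp add: degree_pCons_le)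
  also have "\<dots> = weyl_poly f weyl_H + (\<Sum>n\<le>degree F. weyl_poly (coeff F n) weyl_H * v ^ Suc n)"
    unfolding sum.atMost_Suc_shift by simp
  also have "(\<Sum>n\<le>degree F. weyl_poly (coeff F n) weyl_H * v ^ Suc n) = wsum F v * v"
    unfolding wsum_def sum_distrib_right by (simp add: power_Suc2 mult.assoc del: power_Suc)
  finally show ?thesis .
qed

section \<open>The action on polynomials and uniqueness of coefficients\<close>

lift_definition wact :: "'k::field weyl \<Rightarrow> 'k poly \<Rightarrow> 'k poly" is free_act
proof -
  fix a b :: "'k free_alg" assume "weyl_rel a b"
  then have "free_act (a - b) p = 0" for p
    unfolding weyl_rel_def by (rule free_act_weyl_ideal)
  then show "free_act a = free_act b"
    by (auto simp: free_act_diff)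
qed

lemma wact_add: "wact (a + b) p = wact a p + wact b p"
  by transfer (rule free_act_add)

lemma wact_mult: "wact (a * b) p = wact a (wact b p)"
  by transfer (rule free_act_mult)

lemma wact_0 [simp]: "wact 0 p = 0"
  by transfer simp

lemma wact_const: "wact (weyl_const c) p = smult c p"
  by transfer (simp add: free_act_single word_act_def zero_weyl_word_def)

lemma wact_X: "wact weyl_X p = pCons 0 p"
  by transfer (simp add: free_act_single free_gen_def word_act_def)

lemma wact_Y: "wact weyl_Y p = pderiv p"
  by transfer (simp add: free_act_single free_gen_def word_act_def)

lemma wact_sum: "wact (\<Sum>i\<in>A. f i) p = (\<Sum>i\<in>A. wact (f i) p)"
  by (induction A rule: infinite_finite_induct) (simp_all add: wact_add)

lemma wact_H_monom: "wact weyl_H (monom c j) = monom (of_nat (Suc j) * c) j"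
  by (simp add: wact_mult wact_X wact_Y monom_Suc[symmetric] pderiv_monom del: of_nat_Suc)

text \<open>Monomials are eigenvectors of H = YX: the one of degree j has eigenvalue j + 1.\<close>

lemma wact_poly_monom: "wact (weyl_poly f weyl_H) (monom c j) = monom (poly f (of_nat (Suc j)) * c) j"
proof (induction f)
  case (pCons a f)
  have "wact (weyl_poly (pCons a f) weyl_H) (monom c j)
      = smult a (monom c j) + wact weyl_H (wact (weyl_poly f weyl_H) (monom c j))"
    by (simp only: weyl_poly_pCons wact_add wact_const wact_mult[of weyl_H])
  then show ?case
    unfolding pCons.IH wact_H_monom by (simp add: smult_monom add_monom algebra_simps del: of_nat_Suc)
qed simp

lemma wact_X_power_monom: "wact (weyl_X ^ n) (monom c j) = monom c (n + j)"
proof (induction n)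
  case 0
  have "wact 1 p = p" for p :: "'a poly"
    by transfer simp
  then show ?case by simp
qed (simp add: wact_mult wact_X monom_Suc)

text \<open>On x^j the term f_n(H) X^n acts as f_n(n + j + 1) x^(n + j), and distinct n yield
  distinct degrees. So each f_n vanishes at n + j + 1 for all j, infinitely many points in
  characteristic zero.\<close>

lemma wsum_X_eq_0:
  fixes F :: "'k::field_char_0 poly poly"
  assumes "wsum F weyl_X = 0"
  shows "F = 0"
proof -
  have "poly (coeff F n) (of_nat (Suc (n + j))) = 0" if "n \<le> degree F" for n j
  proof -
    have "0 = coeff (wact (wsum F weyl_X) (monom 1 j)) (n + j)"
      by (simp add: assms)
    also have "\<dots> = (\<Sum>i\<le>degree F. coeff (monom (poly (coeff F i) (of_nat (Suc (i + j)))) (i + j)) (n + j))"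
      by (simp add: wsum_def wact_sum wact_mult wact_X_power_monom wact_poly_monom coeff_sum del: of_nat_Suc)
    also have "\<dots> = (\<Sum>i\<le>degree F. if i = n then poly (coeff F n) (of_nat (Suc (n + j))) else 0)"
      by (rule sum.cong) auto
    also have "\<dots> = poly (coeff F n) (of_nat (Suc (n + j)))"
      using that by simp
    finally show ?thesis by simp
  qed
  then have "range (\<lambda>j. of_nat (Suc (n + j))) \<subseteq> {x. poly (coeff F n) x = 0}"
    if "n \<le> degree F" for n
    using that by blast
  moreover have "infinite (range (\<lambda>j. of_nat (Suc (n + j)) :: 'k))" for n
    by (rule range_inj_infinite) (auto simp: inj_on_def simp del: of_nat_Suc)
  ultimately have "coeff F n = 0" if "n \<le> degree F" for n
    using that poly_roots_finite finite_subset by blast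
  then show ?thesis
    by (metis leading_coeff_0_iff order_refl)
qed

lemma wsum_X_inject:
  fixes F :: "'k::field_char_0 poly poly"
  shows "wsum F weyl_X = wsum G weyl_X \<longleftrightarrow> F = G"
  using wsum_X_eq_0[of "F - G"] by (auto simp: wsum_diff)

subsection \<open>The difference operator\<close>

text \<open>The effect of \<open>ad u\<close> on coefficients: it sends f(H) to
  (\<open>delta f\<close>)(H) u.\<close>

definition delta :: "'k::field poly \<Rightarrow> 'k poly"
  where "delta f = shift 1 f - f"

lemma delta_0 [simp]: "delta 0 = 0"
  by (simp add: delta_def)

lemma delta_add: "delta (f + g) = delta f + delta g"
  by (simp add: delta_def shift_add)

lemma coeff_shift_top:
  assumes "degree f \<le> k"
  shows "coeff (shift n f) k = coeff f k"
proof (cases "degree f = k")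
  case True
  have "lead_coeff (shift n f) = lead_coeff f"
    unfolding shift_def by (subst lead_coeff_comp) auto
  with True show ?thesis by simp
next
  case False
  with assms show ?thesis by (simp add: coeff_eq_0)
qed

text \<open>Induction along delta(c + H g) = H delta(g) - g(H - 1): the second term supplies one
  more copy of the top coefficient, with a minus sign.\<close>

lemma delta_top:
  assumes "degree f \<le> Suc k"
  shows "degree (delta f) \<le> k \<and> coeff (delta f) k = - of_nat (Suc k) * coeff f (Suc k)"
  using assms
proof (induction f arbitrary: k)
  case (pCons c g)
  then have g: "degree g \<le> k"
    by (cases "g = 0") auto
  have eq: "delta (pCons c g) = pCons 0 (delta g) - shift 1 g"
    by (simp add: delta_def shift_pCons)
  show ?case
  proof (cases k)
    case 0
    with g have "g = [:coeff g 0:]"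
      by (metis degree_eq_zeroE coeff_pCons_0 le_zero_eq)
    then obtain b where "g = [:b:]" by blast
    with 0 show ?thesis
      unfolding eq by (simp add: delta_def shift_pCons)
  next
    case (Suc m)
    with pCons.IH[of m] g have IH: "degree (delta g) \<le> m"
        "coeff (delta g) m = - of_nat (Suc m) * coeff g (Suc m)"
      by auto
    have "degree (delta (pCons c g)) \<le> k"
      unfolding eq by (rule degree_diff_le) (use g IH Suc in \<open>simp_all add: degree_pCons_le\<close>)
    moreover have "coeff (shift 1 g) (Suc m) = coeff g (Suc m)"
      using g Suc by (intro coeff_shift_top) simp
    ultimately show ?thesis
      unfolding eq Suc by (simp add: IH algebra_simps)
  qed
qed simp

text \<open>Each step lowers the degree bound by one and multiplies the coefficient there by minus
  the bound. Using \<open>coeff f k\<close> instead of the leading coefficient covers smaller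
  degrees, with value 0.\<close>

lemma delta_funpow:
  "degree f \<le> k \<Longrightarrow> (delta ^^ k) f = [:(- 1) ^ k * fact k * coeff f k:]"
proof (induction k arbitrary: f)
  case 0
  then show ?case
    by (metis degree_eq_zeroE coeff_pCons_0 le_zero_eq fact_0 funpow_0 mult_1 power_0)
next
  case (Suc k)
  note top = delta_top[OF Suc.prems]
  have "(delta ^^ Suc k) f = [:(- 1) ^ k * fact k * coeff (delta f) k:]"
    unfolding funpow_Suc_right o_def using top by (intro Suc.IH) simp
  then show ?case
    using top by (simp add: algebra_simps)
qed

text \<open>The top coefficient of \<open>g\<close> is removed first and the rest is left to
  induction. Bounds are written as vanishing coefficients so that \<open>k = 0\<close> means the
  zero polynomial.\<close>

lemma delta_surj:
  fixes g :: "'k::field_char_0 poly"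
  assumes "\<forall>i\<ge>k. coeff g i = 0"
  shows "\<exists>p. delta p = g \<and> (\<forall>i\<ge>Suc k. coeff p i = 0)"
  using assms
proof (induction k arbitrary: g)
  case 0
  then have "g = 0"
    by (simp add: poly_eq_iff)
  then show ?case
    by (intro exI[of _ 0]) simp
next
  case (Suc k)
  \<comment> \<open>Chosen so that \<open>delta q\<close> and \<open>g\<close> agree at degree
    \<open>k\<close>; dividing by k + 1 needs characteristic zero.\<close>
  define q where "q = monom (- coeff g k / of_nat (Suc k)) (Suc k)"
  have q: "degree q \<le> Suc k" "coeff q (Suc k) = - coeff g k / of_nat (Suc k)"
    by (simp_all add: q_def degree_monom_le)
  have "coeff (g - delta q) i = 0" if "i \<ge> k" for i
  proof (cases "i = k")
    case True
    then show ?thesis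
      using delta_top[OF q(1)] q(2) by (simp del: of_nat_Suc)
  next
    case False
    with that show ?thesis
      using Suc.prems delta_top[OF q(1)] by (simp add: coeff_eq_0)
  qed
  then obtain p where p: "delta p = g - delta q" "\<forall>i\<ge>Suc k. coeff p i = 0"
    using Suc.IH by blast
  have "delta (p + q) = g"
    by (simp add: delta_add p(1))
  moreover have "\<forall>i\<ge>Suc (Suc k). coeff (p + q) i = 0"
    using p(2) by (simp add: q_def)
  ultimately show ?case by blast
qed

text \<open>The equation says that f/g is invariant under the shift, hence constant. Past the last
  natural root of \<open>g\<close> the quotient has the same value at n and n + 1, so
  \<open>f - smult c g\<close> has infinitely many zeros.\<close>

lemma shift_cross_eq:
  fixes f g :: "'k::field_char_0 poly"
  assumes eq: "f * shift 1 g = g * shift 1 f" and "g \<noteq> 0"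
  shows "\<exists>c. f = smult c g"
proof -
  have "finite {n. poly g (of_nat n) = 0}"
  proof -
    have "finite (of_nat -` {x. poly g x = 0} :: nat set)"
      using poly_roots_finite[OF \<open>g \<noteq> 0\<close>] by (rule finite_vimageI) (rule inj_of_nat)
    then show ?thesis
      by (simp add: vimage_def)
  qed
  then obtain N where N: "\<forall>n\<in>{n. poly g (of_nat n) = 0}. n < N"
    using finite_nat_set_iff_bounded by blast
  then have g: "poly g (of_nat n) \<noteq> 0" if "n \<ge> N" for n
    using that by auto
  define c where "c = poly f (of_nat N) / poly g (of_nat N)"
  have val: "poly f (of_nat n) = c * poly g (of_nat n)" if "n \<ge> N" for n
    using that
  proof (induction n rule: dec_induct)
    case base
    then show ?case
      using g[of N] by (simp add: c_def)
  next
    case (step n)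
    have "poly f (of_nat (Suc n)) * poly g (of_nat n) = poly g (of_nat (Suc n)) * poly f (of_nat n)"
      using arg_cong[OF eq, of "\<lambda>p. poly p (of_nat (Suc n))"] by (simp add: poly_shift)
    then show ?case
      using g[of n] step by (simp add: mult.commute mult.left_commute)
  qed
  have "range (\<lambda>n. of_nat (N + n)) \<subseteq> {x. poly (f - smult c g) x = 0}"
    using val by (auto simp del: of_nat_add)
  moreover have "infinite (range (\<lambda>n. of_nat (N + n) :: 'k))"
    by (rule range_inj_infinite) (auto simp: inj_on_def simp del: of_nat_add)
  ultimately have "f - smult c g = 0"
    using poly_roots_finite finite_subset by blast
  then show ?thesis
    by auto
qed

text \<open>For f = \<alpha> this is the coefficient of X^n in u^n, where u = \<alpha>(H) X.\<close>

definition shift_product :: "'k::field poly \<Rightarrow> nat \<Rightarrow> 'k poly"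
  where "shift_product f n = (\<Prod>i<n. shift i f)"

lemma shift_product_Suc: "shift_product f (Suc n) = shift_product f n * shift n f"
  by (simp add: shift_product_def)

text \<open>Splits off the factor \<open>i = 0\<close> rather than the last one. Equating both
  splittings gives the difference equation that governs the centralizer.\<close>

lemma shift_product_Suc_shift: "shift_product f (Suc n) = f * shift 1 (shift_product f n)"
  unfolding shift_product_def by (subst prod.lessThan_Suc_shift) (simp add: shift_prod shift_shift)

lemma shift_product_eq_0_iff: "shift_product f n = 0 \<longleftrightarrow> n > 0 \<and> f = 0"
  by (auto simp: shift_product_def)

lemma degree_shift_product:
  "f \<noteq> 0 \<Longrightarrow> degree (shift_product f n) = n * degree f"
  unfolding shift_product_def by (subst degree_prod_eq_sum_degree) auto

lemma poly_of_coeffs: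
  fixes c :: "nat \<Rightarrow> 'a::comm_monoid_add"
  assumes "\<And>n. n > N \<Longrightarrow> c n = 0"
  obtains F where "\<And>n. coeff F n = c n" "degree F \<le> N"
proof
  let ?F = "\<Sum>n\<le>N. monom (c n) n"
  show coeff: "coeff ?F n = c n" for n
    using assms[of n] by (auto simp: coeff_sum not_le)
  show "degree ?F \<le> N"
    by (rule degree_le) (simp add: coeff assms del: coeff_sum)
qed

section \<open>Iterated inner derivations\<close>

lemma ad_0 [simp]: "ad u 0 = 0"
  by (simp add: ad_def)

lemma ad_add: "ad u (a + b) = ad u a + ad u b"
  by (simp add: ad_def algebra_simps)

lemma ad_diff: "ad u (a - b) = ad u a - ad u b"
  by (simp add: ad_def algebra_simps)

lemma ad_mult_right: "u * b = b * u \<Longrightarrow> ad u (a * b) = ad u a * b"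
  by (simp add: ad_def left_diff_distrib mult.assoc)

lemma ad_mult_left: "u * b = b * u \<Longrightarrow> ad u (b * a) = b * ad u a"
  by (simp add: ad_def right_diff_distrib mult.assoc[symmetric])

lemma ad_funpow_0 [simp]: "(ad u ^^ k) 0 = 0"
  by (induction k) simp_all

lemma ad_funpow_add: "(ad u ^^ k) (a + b) = (ad u ^^ k) a + (ad u ^^ k) b"
  by (induction k) (simp_all add: ad_add)

lemma ad_funpow_sum: "(ad u ^^ k) (\<Sum>i\<in>A. f i) = (\<Sum>i\<in>A. (ad u ^^ k) (f i))"
  by (induction A rule: infinite_finite_induct) (simp_all add: ad_funpow_add)

lemma ad_funpow_mult_right: "u * b = b * u \<Longrightarrow> (ad u ^^ k) (a * b) = (ad u ^^ k) a * b"
  by (induction k) (simp_all add: ad_mult_right)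

lemma ad_funpow_mult_left: "u * b = b * u \<Longrightarrow> (ad u ^^ k) (b * a) = b * (ad u ^^ k) a"
  by (induction k) (simp_all add: ad_mult_left)

section \<open>The element \<open>\<alpha>(H) X\<close>\<close>

lemma wsum_X_mult_X_power: "\<exists>G. wsum F weyl_X * weyl_X ^ n = wsum G weyl_X"
proof (induction n)
  case (Suc n)
  then obtain G where "wsum F weyl_X * weyl_X ^ n = wsum G weyl_X"
    by blast
  then have "wsum F weyl_X * weyl_X ^ Suc n = wsum (pCons 0 G) weyl_X"
    by (simp add: wsum_pCons power_Suc2 mult.assoc[symmetric] del: power_Suc)
  then show ?case
    by blast
qed auto

lemma weyl_Y_X_power: "\<exists>r :: 'k::field poly. weyl_Y ^ n * weyl_X ^ n = weyl_poly r weyl_H"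
proof (induction n)
  case 0
  have "weyl_Y ^ 0 * weyl_X ^ 0 = weyl_poly (1 :: 'k poly) weyl_H"
    by simp
  then show ?case
    by blast
next
  case (Suc n)
  then obtain r :: "'k poly" where r: "weyl_Y ^ n * weyl_X ^ n = weyl_poly r weyl_H"
    by blast
  have "weyl_Y ^ Suc n * weyl_X ^ Suc n = weyl_Y * (weyl_Y ^ n * weyl_X ^ n) * weyl_X"
    by (simp only: power_Suc[of weyl_Y] power_Suc2[of weyl_X] mult.assoc)
  also have "\<dots> = weyl_poly (pcompose r [:1, 1:]) weyl_H * weyl_H"
    unfolding r weyl_Y_commute by (simp only: mult.assoc)
  also have "\<dots> = weyl_poly (pcompose r [:1, 1:] * [:0, 1:]) weyl_H"
    unfolding weyl_poly_mult by (simp add: weyl_poly_pCons)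
  finally show ?case
    by blast
qed

text \<open>f(H) Y^n becomes a polynomial in H after multiplication by X^n; two summands are brought
  to a common power of X.\<close>

lemma mult_X_power_wsum:
  fixes a :: "'k::field weyl"
  shows "\<exists>n F. a * weyl_X ^ n = wsum F weyl_X"
proof (induction a rule: weyl_induct)
  case (X f n)
  have "weyl_poly f weyl_H * weyl_X ^ n * weyl_X ^ 0 = wsum (monom f n) weyl_X"
    by (simp add: wsum_monom)
  then show ?case
    by blast
next
  case (Y f n)
  obtain r :: "'k poly" where r: "weyl_Y ^ n * weyl_X ^ n = weyl_poly r weyl_H"
    using weyl_Y_X_power by blast
  have "weyl_poly f weyl_H * weyl_Y ^ n * weyl_X ^ n = wsum (monom (f * r) 0) weyl_X"
    by (simp add: wsum_monom weyl_poly_mult mult.assoc r)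
  then show ?case
    by blast
next
  case (add a b)
  then obtain m n F G where "a * weyl_X ^ m = wsum F weyl_X" "b * weyl_X ^ n = wsum G weyl_X"
    by blast
  moreover obtain F' G' where "wsum F weyl_X * weyl_X ^ n = wsum F' weyl_X"
      "wsum G weyl_X * weyl_X ^ m = wsum G' weyl_X"
    using wsum_X_mult_X_power by blast
  ultimately have "a * weyl_X ^ (m + n) = wsum F' weyl_X" "b * weyl_X ^ (m + n) = wsum G' weyl_X"
    by (simp add: power_add mult.assoc[symmetric],
        simp add: add.commute[of m] power_add mult.assoc[symmetric])
  then have "(a + b) * weyl_X ^ (m + n) = wsum (F' + G') weyl_X"
    by (simp add: distrib_right wsum_add)
  then show ?case
    by blast
qed

section \<open>Powers of u and the derivation ad u on K[H]\<close>

locale skew_element =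
  fixes \<alpha> :: "'k::field_char_0 poly" and u :: "'k weyl"
  assumes \<alpha>_nz: "\<alpha> \<noteq> 0"
    and u: "u = weyl_poly \<alpha> weyl_H * weyl_X"
begin

lemma u_H: "u * weyl_H = (weyl_H - 1) * u"
proof -
  have "u * weyl_H = weyl_poly \<alpha> weyl_H * weyl_poly [:-1, 1:] weyl_H * weyl_X"
    unfolding u mult.assoc[of _ weyl_X] weyl_X_H by (simp add: weyl_poly_pCons weyl_const_minus mult.assoc)
  also have "weyl_poly \<alpha> weyl_H * weyl_poly [:-1, 1:] weyl_H = weyl_poly [:-1, 1:] weyl_H * weyl_poly \<alpha> weyl_H"
    by (rule weyl_poly_commute)
  finally show ?thesis
    by (simp add: u weyl_poly_pCons weyl_const_minus mult.assoc)
qed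

lemmas u_power_commute = skew_power_commute[OF u_H]

lemma u_commute: "u * weyl_poly f weyl_H = weyl_poly (shift 1 f) weyl_H * u"
  using u_power_commute[of 1 f] by simp

lemma u_power: "u ^ n = weyl_poly (shift_product \<alpha> n) weyl_H * weyl_X ^ n"
proof (induction n)
  case (Suc n)
  have "u ^ Suc n = u ^ n * weyl_poly \<alpha> weyl_H * weyl_X"
    by (simp add: power_Suc2 u mult.assoc del: power_Suc)
  also have "\<dots> = weyl_poly (shift n \<alpha>) weyl_H * weyl_poly (shift_product \<alpha> n) weyl_H * weyl_X ^ Suc n"
    unfolding u_power_commute by (simp add: Suc.IH mult.assoc power_Suc2 del: power_Suc)
  finally show ?case
    by (simp add: shift_product_Suc mult.commute[of "shift_product \<alpha> n"] weyl_poly_mult del: power_Suc)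
qed (simp add: shift_product_def)

text \<open>u Y = \<open>\<gamma>\<close>(H), by XY = H - 1.\<close>

abbreviation "\<gamma> \<equiv> \<alpha> * [:-1, 1:]"

text \<open>This expresses Y^n as u^(-n) times a polynomial in H, whose degree n (deg \<alpha> + 1)
  is the source of the divisor d + 1 in the theorem. In the induction the innermost u Y becomes
  \<gamma>(H) and is moved to the left past u^n.\<close>

lemma u_Y_power: "u ^ n * weyl_Y ^ n = weyl_poly (shift_product \<gamma> n) weyl_H"
proof (induction n)
  case (Suc n)
  have uY: "u * weyl_Y = weyl_poly \<gamma> weyl_H"
    unfolding weyl_poly_mult by (simp add: u mult.assoc weyl_XY weyl_poly_pCons weyl_const_minus)
  have "u ^ Suc n * weyl_Y ^ Suc n = u ^ n * (u * weyl_Y) * weyl_Y ^ n"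
    by (simp only: power_Suc[of weyl_Y] power_Suc2[of u] mult.assoc)
  also have "\<dots> = weyl_poly (shift n \<gamma>) weyl_H * (u ^ n * weyl_Y ^ n)"
    unfolding uY u_power_commute by (simp only: mult.assoc)
  also have "\<dots> = weyl_poly (shift_product \<gamma> (Suc n)) weyl_H"
    unfolding Suc.IH by (simp only: shift_product_Suc mult.commute[of "shift_product \<gamma> n"] weyl_poly_mult)
  finally show ?case .
qed (simp add: shift_product_def)

lemma degree_\<gamma>_product: "degree (shift_product \<gamma> n) = n * Suc (degree \<alpha>)"
proof -
  have nz: "\<gamma> \<noteq> 0"
    using \<alpha>_nz by (simp only: mult_eq_0_iff) simp
  have "degree \<gamma> = Suc (degree \<alpha>)"
    using \<alpha>_nz by (subst degree_mult_eq) auto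
  then show ?thesis
    using degree_shift_product[OF nz, of n] by (simp only:)
qed

lemma ad_poly_H: "ad u (weyl_poly f weyl_H) = weyl_poly (delta f) weyl_H * u"
  by (simp add: ad_def u_commute delta_def weyl_poly_diff left_diff_distrib)

lemma ad_funpow_poly_H: "(ad u ^^ k) (weyl_poly f weyl_H) = weyl_poly ((delta ^^ k) f) weyl_H * u ^ k"
proof (induction k)
  case (Suc k)
  have "u * u ^ k = u ^ k * u"
    by (rule power_commutes[symmetric])
  then show ?case
    by (simp add: Suc.IH ad_mult_right ad_poly_H mult.assoc)
qed simp

lemma ad_funpow_poly_H_top:
  assumes "degree f \<le> k"
  shows "(ad u ^^ k) (weyl_poly f weyl_H) = weyl_const ((- 1) ^ k * fact k * coeff f k) * u ^ k"
  unfolding ad_funpow_poly_H delta_funpow[OF assms] weyl_poly_const ..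

section \<open>Expansions in powers of X and in powers of u\<close>

lemma u_wsum_X:
  obtains G where "u * wsum F weyl_X = wsum (pCons 0 G) weyl_X"
    "\<And>n. coeff G n = \<alpha> * shift 1 (coeff F n)"
proof -
  obtain G where G: "\<And>n. coeff G n = \<alpha> * shift 1 (coeff F n)" "degree G \<le> degree F"
    by (rule poly_of_coeffs[of "degree F" "\<lambda>n. \<alpha> * shift 1 (coeff F n)"]) (auto simp: coeff_eq_0)
  have "u * (weyl_poly (coeff F n) weyl_H * weyl_X ^ n)
      = weyl_poly (coeff G n) weyl_H * weyl_X ^ n * weyl_X" for n
  proof -
    have "u * (weyl_poly (coeff F n) weyl_H * weyl_X ^ n)
        = weyl_poly (shift 1 (coeff F n)) weyl_H * weyl_poly \<alpha> weyl_H * (weyl_X * weyl_X ^ n)"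
      by (simp add: mult.assoc[symmetric] u_commute) (simp add: u mult.assoc)
    then show ?thesis
      by (simp only: G(1) weyl_poly_mult weyl_poly_commute[of \<alpha>] power_commutes[symmetric] mult.assoc)
  qed
  then have "u * wsum F weyl_X = wsum (pCons 0 G) weyl_X"
    by (simp add: wsum_pCons wsum_superset[OF G(2)] wsum_def[of F] sum_distrib_left sum_distrib_right)
  with G(1) show ?thesis
    using that by blast
qed

text \<open>Both this and left multiplication by \<open>u\<close> raise the exponent of X by one,
  whence \<open>pCons 0\<close>; comparing the two coefficient sequences turns commutation with
  \<open>u\<close> into difference equations.\<close>

lemma wsum_X_u:
  obtains G where "wsum F weyl_X * u = wsum (pCons 0 G) weyl_X"
    "\<And>n. coeff G n = coeff F n * shift n \<alpha>"
proof -
  obtain G where G: "\<And>n. coeff G n = coeff F n * shift n \<alpha>" "degree G \<le> degree F"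
    by (rule poly_of_coeffs[of "degree F" "\<lambda>n. coeff F n * shift n \<alpha>"]) (auto simp: coeff_eq_0)
  have "weyl_poly (coeff F n) weyl_H * weyl_X ^ n * u
      = weyl_poly (coeff G n) weyl_H * weyl_X ^ n * weyl_X" for n
  proof -
    have "weyl_poly (coeff F n) weyl_H * weyl_X ^ n * u
        = weyl_poly (coeff F n) weyl_H * (weyl_X ^ n * weyl_poly \<alpha> weyl_H) * weyl_X"
      by (simp only: u mult.assoc)
    then show ?thesis
      by (simp only: weyl_X_power_commute G(1) weyl_poly_mult mult.assoc)
  qed
  then have "wsum F weyl_X * u = wsum (pCons 0 G) weyl_X"
    by (simp add: wsum_pCons wsum_superset[OF G(2)] wsum_def[of F] sum_distrib_right)
  with G(1) show ?thesis
    using that by blast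
qed

lemma wsum_u:
  obtains F where "wsum G u = wsum F weyl_X" "\<And>n. coeff F n = coeff G n * shift_product \<alpha> n"
proof -
  obtain F where F: "\<And>n. coeff F n = coeff G n * shift_product \<alpha> n" "degree F \<le> degree G"
    by (rule poly_of_coeffs[of "degree G" "\<lambda>n. coeff G n * shift_product \<alpha> n"]) (auto simp: coeff_eq_0)
  have "wsum G u = wsum F weyl_X"
    unfolding wsum_superset[OF F(2)] wsum_def[of G]
    by (simp add: F(1) u_power weyl_poly_mult mult.assoc)
  with F(1) show ?thesis
    using that by blast
qed

text \<open>X-expansions are unique, so a u-expansion determines the X-coefficients through u^n =
  \<open>shift_product \<alpha> n\<close> X^n.\<close>

lemma wsum_u_coeff:
  assumes "wsum F weyl_X = wsum G u"
  shows "coeff F n = coeff G n * shift_product \<alpha> n"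
  by (rule wsum_u[of G]) (use assms in \<open>simp add: wsum_X_inject\<close>)

lemma weyl_poly_u_wsum: "weyl_poly p u = wsum (map_poly (\<lambda>c. [:c:]) p) u"
  by (simp add: weyl_poly_def wsum_superset[OF map_poly_degree_leq] coeff_map_poly weyl_poly_const)

lemma weyl_poly_u_eq_0:
  assumes "weyl_poly p u = 0"
  shows "p = 0"
proof (rule poly_eqI)
  fix n
  have "wsum 0 weyl_X = wsum (map_poly (\<lambda>c. [:c:]) p) u"
    using assms by (simp add: weyl_poly_u_wsum)
  from wsum_u_coeff[OF this, of n] show "coeff p n = coeff 0 n"
    using \<alpha>_nz by (simp add: coeff_map_poly shift_product_eq_0_iff)
qed

lemma weyl_poly_u_inject: "weyl_poly p u = weyl_poly q u \<longleftrightarrow> p = q"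
  using weyl_poly_u_eq_0[of "p - q"] by (auto simp: weyl_poly_diff)

text \<open>After multiplication by a power of X on the right, \<open>a\<close> has an X-expansion;
  there \<open>u\<close> acts on coefficients by a shift and multiplication by \<alpha>, both
  injective.\<close>

lemma u_cancel:
  assumes "u * a = 0"
  shows "a = 0"
proof -
  obtain n F where F: "a * weyl_X ^ n = wsum F weyl_X"
    using mult_X_power_wsum by blast
  obtain G where G: "u * wsum F weyl_X = wsum (pCons 0 G) weyl_X"
      "\<And>n. coeff G n = \<alpha> * shift 1 (coeff F n)"
    by (rule u_wsum_X[of F]) blast
  have "wsum (pCons 0 G) weyl_X = 0"
    using assms by (simp add: G(1)[symmetric] F[symmetric] mult.assoc[symmetric])
  then have "G = 0"
    using wsum_X_eq_0 by fastforce
  then have "coeff F m = 0" for m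
    using G(2)[of m] \<alpha>_nz by simp
  then have "F = 0"
    by (simp add: poly_eq_iff)
  with F show ?thesis
    using weyl_X_power_cancel_right by simp
qed

lemma u_power_cancel:
  assumes "u ^ n * a = u ^ n * b"
  shows "a = b"
proof -
  have "u ^ n * c = 0 \<Longrightarrow> c = 0" for c
    by (induction n) (auto simp: mult.assoc dest: u_cancel)
  from this[of "a - b"] assms show ?thesis
    by (simp add: right_diff_distrib)
qed

subsection \<open>The generalized kernel\<close>

text \<open>The coefficients solve \<alpha>(H) f_n(H - 1) = f_n(H) \<alpha>(H - n), as does
  \<open>shift_product \<alpha> n\<close>. The quotient of the two is shift-invariant, so f_n is a
  scalar multiple of the product.\<close>

lemma ad_kernel_wsum_X:
  assumes "ad u (wsum F weyl_X) = 0"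
  shows "\<exists>G. wsum F weyl_X = wsum G u \<and> (\<forall>n. \<forall>i\<ge>1. coeff (coeff G n) i = 0)"
proof -
  obtain G1 where G1: "u * wsum F weyl_X = wsum (pCons 0 G1) weyl_X"
      "\<And>n. coeff G1 n = \<alpha> * shift 1 (coeff F n)"
    by (rule u_wsum_X[of F]) blast
  obtain G2 where G2: "wsum F weyl_X * u = wsum (pCons 0 G2) weyl_X"
      "\<And>n. coeff G2 n = coeff F n * shift n \<alpha>"
    by (rule wsum_X_u[of F]) blast
  have "G1 = G2"
    using assms by (simp add: ad_def G1(1) G2(1) wsum_X_inject)
  have "\<exists>c. coeff F n = smult c (shift_product \<alpha> n)" for n
  proof (rule shift_cross_eq)
    let ?p = "shift_product \<alpha> n"
    have "\<alpha> * shift 1 (coeff F n) = coeff F n * shift n \<alpha>"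
      using G1(2)[of n] G2(2)[of n] \<open>G1 = G2\<close> by simp
    moreover have "\<alpha> * shift 1 ?p = ?p * shift n \<alpha>"
      using shift_product_Suc[of \<alpha> n] shift_product_Suc_shift[of \<alpha> n] by simp
    ultimately have "\<alpha> * (coeff F n * shift 1 ?p) = \<alpha> * (?p * shift 1 (coeff F n))"
      by (simp only: mult.left_commute[of \<alpha>]) (simp only: mult.left_commute)
    then show "coeff F n * shift 1 ?p = ?p * shift 1 (coeff F n)"
      using \<alpha>_nz by simp
  qed (simp add: shift_product_eq_0_iff \<alpha>_nz)
  then obtain c where c: "\<And>n. coeff F n = smult (c n) (shift_product \<alpha> n)"
    by metis
  obtain G where G: "\<And>n. coeff G n = (if n \<le> degree F then [:c n:] else 0)"
    by (rule poly_of_coeffs[of "degree F" "\<lambda>n. if n \<le> degree F then [:c n:] else 0"]) auto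
  obtain F' where F': "wsum G u = wsum F' weyl_X"
      "\<And>n. coeff F' n = coeff G n * shift_product \<alpha> n"
    by (rule wsum_u[of G]) blast
  have "F' = F"
    by (rule poly_eqI) (auto simp: F'(2) G c[symmetric] coeff_eq_0)
  moreover have "\<forall>n. \<forall>i\<ge>1. coeff (coeff G n) i = 0"
    by (auto simp: G coeff_pCons split: nat.splits)
  ultimately show ?thesis
    using F'(1) by metis
qed

text \<open>\<open>ad u\<close> applies \<open>delta\<close> to each coefficient and raises the
  power of u by one, so \<open>delta_surj\<close> is used coefficientwise. The factor
  \<open>u\<close> on the right reflects that the image has no term in u^0.\<close>

lemma ad_surj_wsum_u:
  assumes "\<forall>n. \<forall>i\<ge>k. coeff (coeff G n) i = 0"
  shows "\<exists>P. ad u (wsum P u) = wsum G u * u \<and> (\<forall>n. \<forall>i\<ge>Suc k. coeff (coeff P n) i = 0)"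
  using assms
proof (induction G)
  case 0
  then show ?case
    by (intro exI[of _ 0]) simp
next
  case (pCons g G)
  have "\<forall>i\<ge>k. coeff g i = 0"
    using pCons.prems by (metis coeff_pCons_0)
  then obtain p where p: "delta p = g" "\<forall>i\<ge>Suc k. coeff p i = 0"
    using delta_surj by blast
  have "\<forall>n. \<forall>i\<ge>k. coeff (coeff G n) i = 0"
    using pCons.prems by (metis coeff_pCons_Suc)
  then obtain P where P: "ad u (wsum P u) = wsum G u * u"
      "\<forall>n. \<forall>i\<ge>Suc k. coeff (coeff P n) i = 0"
    using pCons.IH by blast
  have "ad u (wsum (pCons p P) u) = wsum (pCons g G) u * u"
    by (simp add: wsum_pCons ad_add ad_mult_right ad_poly_H P(1) p(1) distrib_right)
  moreover have "\<forall>n. \<forall>i\<ge>Suc k. coeff (coeff (pCons p P) n) i = 0"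
    using p(2) P(2) by (auto simp: coeff_pCons split: nat.split)
  ultimately show ?case
    by blast
qed

text \<open>By induction \<open>ad u\<close> of the element has a u-expansion with coefficients of
  degree below \<open>k\<close>; an antiderivative of it under \<open>ad u\<close> differs from the
  element by a member of the centralizer.\<close>

lemma ad_funpow_kernel_wsum_X:
  assumes "(ad u ^^ k) (wsum F weyl_X) = 0"
  shows "\<exists>G. wsum F weyl_X = wsum G u \<and> (\<forall>n. \<forall>i\<ge>k. coeff (coeff G n) i = 0)"
  using assms
proof (induction k arbitrary: F)
  case 0
  then show ?case
    by (intro exI[of _ 0]) simp
next
  case (Suc k)
  obtain G1 where G1: "u * wsum F weyl_X = wsum (pCons 0 G1) weyl_X"
    by (rule u_wsum_X[of F]) blast
  obtain G2 where G2: "wsum F weyl_X * u = wsum (pCons 0 G2) weyl_X"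
    by (rule wsum_X_u[of F]) blast
  have ad_F: "ad u (wsum F weyl_X) = wsum (pCons 0 (G1 - G2)) weyl_X"
    by (simp add: ad_def G1 G2 wsum_pCons wsum_diff left_diff_distrib)
  have "(ad u ^^ k) (wsum (pCons 0 (G1 - G2)) weyl_X) = 0"
    using Suc.prems by (simp add: ad_F[symmetric] funpow_swap1)
  from Suc.IH[OF this] obtain G where
    G: "wsum (pCons 0 (G1 - G2)) weyl_X = wsum G u" "\<forall>n. \<forall>i\<ge>k. coeff (coeff G n) i = 0"
    by blast
  \<comment> \<open>The X-expansion of the image starts at X^1, so its u-expansion is a right
    multiple of u, as \<open>ad_surj_wsum_u\<close> requires.\<close>
  have "coeff G 0 = 0"
    using wsum_u_coeff[OF G(1), of 0] by (simp add: shift_product_def)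
  then obtain G' where G': "G = pCons 0 G'"
    by (metis pCons_cases coeff_pCons_0)
  have "\<forall>n. \<forall>i\<ge>k. coeff (coeff G' n) i = 0"
    using G(2) G' by (metis coeff_pCons_Suc)
  then obtain P where P: "ad u (wsum P u) = wsum G' u * u"
      "\<forall>n. \<forall>i\<ge>Suc k. coeff (coeff P n) i = 0"
    using ad_surj_wsum_u by blast
  obtain P' where P': "wsum P u = wsum P' weyl_X"
    by (rule wsum_u[of P]) blast
  have "ad u (wsum (F - P') weyl_X) = 0"
    by (simp add: wsum_diff ad_diff ad_F G(1) P'[symmetric] P(1)) (simp add: G' wsum_pCons)
  then obtain C where C: "wsum (F - P') weyl_X = wsum C u" "\<forall>n. \<forall>i\<ge>1. coeff (coeff C n) i = 0"
    using ad_kernel_wsum_X by blast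
  have "wsum F weyl_X = wsum (C + P) u"
    using C(1) by (simp add: wsum_diff wsum_add P' algebra_simps)
  moreover have "\<forall>n. \<forall>i\<ge>Suc k. coeff (coeff (C + P) n) i = 0"
    using C(2) P(2) by simp
  ultimately show ?case
    by blast
qed

text \<open>Left multiplication by u^M turns f(H) X^m into a term of exponent at least M, on which
  there is no condition. It turns f(H) Y^m into f(H - M) u^(M - m) (u^m Y^m), where the last factor
  is \<open>shift_product \<gamma> m\<close>. Quantifying over all large M lets two summands share
  one M.\<close>

lemma u_power_mult_wsum:
  "\<exists>N. \<forall>M\<ge>N. \<exists>F. u ^ M * a = wsum F weyl_X
    \<and> (\<forall>n<M. shift_product \<alpha> n * shift n (shift_product \<gamma> (M - n)) dvd coeff F n)"
proof (induction a rule: weyl_induct)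
  case (X f m)
  have "u ^ M * (weyl_poly f weyl_H * weyl_X ^ m)
      = wsum (monom (shift M f * shift_product \<alpha> M) (M + m)) weyl_X" for M
    unfolding mult.assoc[symmetric] u_power_commute
    by (simp add: wsum_monom weyl_poly_mult u_power power_add mult.assoc)
  moreover have "\<forall>n<M. shift_product \<alpha> n * shift n (shift_product \<gamma> (M - n))
      dvd coeff (monom (shift M f * shift_product \<alpha> M) (M + m)) n" for M
    by simp
  ultimately show ?case
    by blast
next
  case (Y f m)
  show ?case
  proof (rule exI[of _ m], intro allI impI)
    fix M assume "m \<le> M"
    then obtain n where M: "M = n + m"
      by (metis le_Suc_ex add.commute)
    let ?p = "shift n (shift_product \<gamma> m)"
    let ?F = "monom (shift M f * (shift_product \<alpha> n * ?p)) n"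
    have "u ^ M * (weyl_poly f weyl_H * weyl_Y ^ m)
        = weyl_poly (shift M f) weyl_H * (u ^ n * (u ^ m * weyl_Y ^ m))"
      unfolding mult.assoc[symmetric] u_power_commute by (simp add: M power_add mult.assoc)
    also have "\<dots> = weyl_poly (shift M f) weyl_H * (weyl_poly ?p weyl_H * u ^ n)"
      unfolding u_Y_power u_power_commute ..
    also have "\<dots> = wsum ?F weyl_X"
      unfolding u_power wsum_monom mult.commute[of "shift_product \<alpha> n"]
      by (simp only: weyl_poly_mult mult.assoc)
    finally have "u ^ M * (weyl_poly f weyl_H * weyl_Y ^ m) = wsum ?F weyl_X" .
    moreover have "shift_product \<alpha> k * shift k (shift_product \<gamma> (M - k)) dvd coeff ?F k" for k
      by (cases "k = n") (simp_all add: M)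
    ultimately show "\<exists>F. u ^ M * (weyl_poly f weyl_H * weyl_Y ^ m) = wsum F weyl_X
        \<and> (\<forall>n<M. shift_product \<alpha> n * shift n (shift_product \<gamma> (M - n)) dvd coeff F n)"
      by blast
  qed
next
  case (add a b)
  then obtain N1 N2 where N1: "\<forall>M\<ge>N1. \<exists>F. u ^ M * a = wsum F weyl_X
      \<and> (\<forall>n<M. shift_product \<alpha> n * shift n (shift_product \<gamma> (M - n)) dvd coeff F n)"
    and N2: "\<forall>M\<ge>N2. \<exists>F. u ^ M * b = wsum F weyl_X
      \<and> (\<forall>n<M. shift_product \<alpha> n * shift n (shift_product \<gamma> (M - n)) dvd coeff F n)"
    by blast
  show ?case
  proof (rule exI[of _ "max N1 N2"], intro allI impI)
    fix M assume "max N1 N2 \<le> M"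
    then have "N1 \<le> M" "N2 \<le> M"
      by simp_all
    from N1[rule_format, OF this(1)] obtain F where F: "u ^ M * a = wsum F weyl_X"
      "\<forall>n<M. shift_product \<alpha> n * shift n (shift_product \<gamma> (M - n)) dvd coeff F n"
      by (elim exE conjE)
    from N2[rule_format, OF \<open>N2 \<le> M\<close>] obtain G where G: "u ^ M * b = wsum G weyl_X"
      "\<forall>n<M. shift_product \<alpha> n * shift n (shift_product \<gamma> (M - n)) dvd coeff G n"
      by (elim exE conjE)
    show "\<exists>F. u ^ M * (a + b) = wsum F weyl_X
        \<and> (\<forall>n<M. shift_product \<alpha> n * shift n (shift_product \<gamma> (M - n)) dvd coeff F n)"
    proof (intro exI conjI allI impI)
      show "u ^ M * (a + b) = wsum (F + G) weyl_X"
        by (simp only: distrib_left wsum_add F G)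
      show "shift_product \<alpha> n * shift n (shift_product \<gamma> (M - n)) dvd coeff (F + G) n"
        if "n < M" for n
        unfolding coeff_add by (intro dvd_add F(2)[rule_format] G(2)[rule_format] that)
    qed
  qed
qed

text \<open>\<open>M\<close> is large enough for \<open>u ^ M * a\<close> to involve no negative powers of \<open>u\<close>. Divisibility by
  \<open>\<gamma>(H)\<gamma>(H - 1)\<dots>\<close> then forces the coefficient of \<open>u ^ n\<close>, of degree at most \<open>k\<close>, to vanish
  when \<open>(M - n) * (deg \<alpha> + 1) > k\<close>.\<close>

lemma ad_ideal_subset:
  assumes "a \<in> ad_ker u k"
  shows "\<exists>p. (ad u ^^ k) a = u ^ (k - k div Suc (degree \<alpha>)) * weyl_poly p u"
proof -
  define q where "q = k div Suc (degree \<alpha>)"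
  have "q \<le> k"
    by (simp add: q_def)
  obtain N where N: "\<forall>M\<ge>N. \<exists>F. u ^ M * a = wsum F weyl_X
      \<and> (\<forall>n<M. shift_product \<alpha> n * shift n (shift_product \<gamma> (M - n)) dvd coeff F n)"
    using u_power_mult_wsum by blast
  define M where "M = N + k"
  obtain F where F: "u ^ M * a = wsum F weyl_X"
    and dvd: "\<And>n. n < M \<Longrightarrow> shift_product \<alpha> n * shift n (shift_product \<gamma> (M - n)) dvd coeff F n"
    using N[rule_format, of M] by (auto simp: M_def simp del: mult_pCons_right)
  have u_comm: "u * u ^ n = u ^ n * u" for n
    by (rule power_commutes[symmetric])
  have "(ad u ^^ Suc k) a = 0"
    using assms by (simp only: ad_ker_def mem_Collect_eq Suc_eq_plus1)
  then have "(ad u ^^ Suc k) (wsum F weyl_X) = 0"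
    unfolding F[symmetric] ad_funpow_mult_left[OF u_comm] by simp
  from ad_funpow_kernel_wsum_X[OF this] obtain G where
    G: "wsum F weyl_X = wsum G u" "\<And>n i. i \<ge> Suc k \<Longrightarrow> coeff (coeff G n) i = 0"
    by blast
  have deg: "degree (coeff G n) \<le> k" for n
    by (rule degree_le) (simp add: G(2) Suc_le_eq)
  have zero: "coeff G n = 0" if "n < M - q" for n
  proof (rule ccontr)
    assume nz: "coeff G n \<noteq> 0"
    have "n < M"
      using that by simp
    \<comment> \<open>The factor \<open>shift_product \<alpha> n\<close> only comes from rewriting
      u^n through X and cancels; what remains is a divisor of degree (M - n)(deg \<alpha> +
      1).\<close>
    then have "shift n (shift_product \<gamma> (M - n)) dvd coeff G n"
      using dvd[of n] \<alpha>_nz unfolding wsum_u_coeff[OF G(1)] mult.commute[of "coeff G n"]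
      by (simp add: shift_product_eq_0_iff)
    then have "degree (shift n (shift_product \<gamma> (M - n))) \<le> k"
      using dvd_imp_degree_le[OF _ nz] deg[of n] by (meson order_trans)
    then have "(M - n) * Suc (degree \<alpha>) \<le> k"
      by (simp only: degree_shift degree_\<gamma>_product)
    then have "M - n \<le> q"
      unfolding q_def by (simp add: less_eq_div_iff_mult_less_eq)
    with that \<open>n < M\<close> show False
      by linarith
  qed
  \<comment> \<open>The constant left by \<open>k\<close> differences of the coefficient of
    u^n.\<close>
  define c where "c n = (- 1) ^ k * fact k * coeff (coeff G n) k" for n
  have "u ^ M * (ad u ^^ k) a = (ad u ^^ k) (wsum G u)"
    by (simp add: ad_funpow_mult_left[OF u_comm, symmetric] F G(1))
  also have "\<dots> = (\<Sum>n\<le>degree G. (ad u ^^ k) (weyl_poly (coeff G n) weyl_H) * u ^ n)"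
    by (simp add: wsum_def ad_funpow_sum ad_funpow_mult_right[OF u_comm])
  \<comment> \<open>For n < M - q the exponent n + q - M is truncated to 0, but then
    \<open>c n\<close> is 0.\<close>
  also have "\<dots> = (\<Sum>n\<le>degree G. u ^ (M + (k - q)) * weyl_poly (monom (c n) (n + q - M)) u)"
  proof (rule sum.cong)
    fix n
    show "(ad u ^^ k) (weyl_poly (coeff G n) weyl_H) * u ^ n
        = u ^ (M + (k - q)) * weyl_poly (monom (c n) (n + q - M)) u"
    proof (cases "n < M - q")
      case True
      then show ?thesis
        by (simp add: zero c_def)
    next
      case False
      then have "k + n = M + (k - q) + (n + q - M)"
        using \<open>q \<le> k\<close> by (simp add: M_def)
      then have "u ^ k * u ^ n = u ^ (M + (k - q)) * u ^ (n + q - M)"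
        by (simp only: power_add[symmetric])
      then have "weyl_const (c n) * u ^ k * u ^ n
          = weyl_const (c n) * (u ^ (M + (k - q)) * u ^ (n + q - M))"
        by (simp only: mult.assoc)
      also have "\<dots> = u ^ (M + (k - q)) * (weyl_const (c n) * u ^ (n + q - M))"
        by (simp only: mult.assoc[symmetric] weyl_const_commute[of "c n" "u ^ (M + (k - q))"])
      finally show ?thesis
        unfolding ad_funpow_poly_H_top[OF deg] c_def[symmetric] weyl_poly_monom .
    qed
  qed simp
  also have "\<dots> = u ^ M * (u ^ (k - q) * weyl_poly (\<Sum>n\<le>degree G. monom (c n) (n + q - M)) u)"
    by (simp add: weyl_poly_sum sum_distrib_left power_add mult.assoc)
  finally show ?thesis
    unfolding q_def[symmetric] by (intro exI) (rule u_power_cancel)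
qed

text \<open>The witness is H^r Y^q, with q and r the quotient and remainder of \<open>k\<close> by
  deg \<alpha> + 1, times a polynomial in u. As u^q H^r Y^q is a polynomial in H of degree exactly
  \<open>k\<close>, its image under the k-th power of \<open>ad u\<close> is a nonzero multiple of
  u^k.\<close>

lemma ad_ideal_superset:
  "\<exists>a\<in>ad_ker u k. (ad u ^^ k) a = u ^ (k - k div Suc (degree \<alpha>)) * weyl_poly p u"
proof -
  define q where "q = k div Suc (degree \<alpha>)"
  define r where "r = k mod Suc (degree \<alpha>)"
  have "q \<le> k"
    by (simp add: q_def)
  define a :: "'k weyl" where "a = weyl_poly (monom 1 r) weyl_H * weyl_Y ^ q"
  define f where "f = shift q (monom 1 r) * shift_product \<gamma> q"
  have f_nz: "f \<noteq> 0"
    unfolding f_def using \<alpha>_nz by (simp add: shift_product_eq_0_iff monom_eq_0_iff del: mult_pCons_right)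
  then have "degree f = r + q * Suc (degree \<alpha>)"
    unfolding f_def by (subst degree_mult_eq)
      (auto simp: degree_monom_eq degree_\<gamma>_product simp del: mult_pCons_right)
  then have deg: "degree f = k"
    unfolding q_def r_def by (simp only: mod_div_mult_eq)
  define c where "c = (- 1) ^ k * fact k * lead_coeff f"
  have "c \<noteq> 0"
    using f_nz by (simp add: c_def)
  have u_comm: "u * u ^ n = u ^ n * u" for n
    by (rule power_commutes[symmetric])
  have "u ^ q * a = weyl_poly f weyl_H"
    unfolding a_def mult.assoc[symmetric] u_power_commute f_def weyl_poly_mult[of "shift q _"]
    by (simp only: mult.assoc u_Y_power)
  then have "u ^ q * (ad u ^^ k) a = weyl_const c * u ^ k"
    by (simp add: ad_funpow_mult_left[OF u_comm, symmetric] ad_funpow_poly_H_top deg c_def)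
  also have "\<dots> = u ^ q * (weyl_const c * u ^ (k - q))"
  proof -
    have "u ^ k = u ^ q * u ^ (k - q)"
      using \<open>q \<le> k\<close> by (simp add: power_add[symmetric])
    then show ?thesis
      by (simp only: weyl_const_commute mult.assoc)
  qed
  finally have top: "(ad u ^^ k) a = weyl_const c * u ^ (k - q)"
    by (rule u_power_cancel)
  \<comment> \<open>A factor from K[u] passes through \<open>ad u\<close>, so it can adjust the
    value; 1/c normalizes it.\<close>
  define b where "b = weyl_poly (smult (1 / c) p) u"
  have b_comm: "u * b = b * u"
    unfolding b_def using weyl_poly_commute_power[of _ u 1] by simp
  have "(ad u ^^ k) (a * b) = weyl_const c * (u ^ (k - q) * b)"
    by (simp add: ad_funpow_mult_right[OF b_comm] top mult.assoc)
  also have "\<dots> = u ^ (k - q) * (weyl_const c * weyl_const (1 / c) * weyl_poly p u)"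
    by (simp only: b_def weyl_poly_smult mult.assoc[symmetric] weyl_const_commute[of c "u ^ (k - q)"])
  also have "\<dots> = u ^ (k - q) * weyl_poly p u"
    using \<open>c \<noteq> 0\<close> by (simp add: weyl_const_mult[symmetric])
  finally have ab: "(ad u ^^ k) (a * b) = u ^ (k - q) * weyl_poly p u" .
  \<comment> \<open>The value lies in K[u], hence is killed by one more \<open>ad u\<close>.\<close>
  have "ad u (u ^ (k - q) * weyl_poly p u) = 0"
    unfolding ad_mult_left[OF u_comm] using weyl_poly_commute_power[of p u 1] by (simp add: ad_def)
  then have "a * b \<in> ad_ker u k"
    by (simp add: ad_ker_def ab)
  with ab show ?thesis
    unfolding q_def by blast
qed

section \<open>The ideals I_k, their products and the nilpotent type of u\<close>

lemma ad_ideal_eq: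
  "ad_ideal u k = (\<lambda>a. u ^ (k - k div Suc (degree \<alpha>)) * a) ` gen_subalg u"
proof (intro equalityI subsetI)
  fix x assume "x \<in> ad_ideal u k"
  then obtain a where "a \<in> ad_ker u k" "x = (ad u ^^ k) a"
    unfolding ad_ideal_def by blast
  with ad_ideal_subset[of a k] show "x \<in> (\<lambda>a. u ^ (k - k div Suc (degree \<alpha>)) * a) ` gen_subalg u"
    unfolding gen_subalg_def by blast
next
  fix x assume "x \<in> (\<lambda>a. u ^ (k - k div Suc (degree \<alpha>)) * a) ` gen_subalg u"
  then obtain p where "x = u ^ (k - k div Suc (degree \<alpha>)) * weyl_poly p u"
    unfolding gen_subalg_def by blast
  with ad_ideal_superset[of k p] show "x \<in> ad_ideal u k"
    unfolding ad_ideal_def by (metis imageI)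
qed

text \<open>For index 0 the ideal is the kernel of \<open>ad u\<close> itself and the exponent is
  0.\<close>

lemma centralizer_eq: "centralizer u = gen_subalg u"
  using ad_ideal_eq[of 0] by (simp add: ad_ideal_def ad_ker_def centralizer_def)

text \<open>Elements of K[u] commute, so the powers of \<open>u\<close> combine in each product;
  sums of multiples of u^(m + n) are again such multiples.\<close>

lemma ideal_mult_subset:
  assumes "A \<subseteq> (\<lambda>a. u ^ m * a) ` gen_subalg u" "B \<subseteq> (\<lambda>a. u ^ n * a) ` gen_subalg u"
  shows "ideal_mult A B \<subseteq> (\<lambda>a. u ^ (m + n) * a) ` gen_subalg u"
proof
  fix x assume "x \<in> ideal_mult A B"
  then obtain l f g where x: "x = (\<Sum>j<(l::nat). f j * g j)"
    and "\<forall>j<l. f j \<in> A" "\<forall>j<l. g j \<in> B"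
    unfolding ideal_mult_def by blast
  with assms have "\<forall>j<l. \<exists>p. f j = u ^ m * weyl_poly p u" "\<forall>j<l. \<exists>p. g j = u ^ n * weyl_poly p u"
    unfolding gen_subalg_def by blast+
  then obtain p q where pq: "\<And>j. j < l \<Longrightarrow> f j = u ^ m * weyl_poly (p j) u"
      "\<And>j. j < l \<Longrightarrow> g j = u ^ n * weyl_poly (q j) u"
    by metis
  have "f j * g j = u ^ (m + n) * weyl_poly (p j * q j) u" if "j < l" for j
  proof -
    have "f j * g j = u ^ m * (weyl_poly (p j) u * u ^ n) * weyl_poly (q j) u"
      by (simp only: pq[OF that] mult.assoc)
    then show ?thesis
      by (simp only: weyl_poly_commute_power weyl_poly_mult power_add mult.assoc)
  qed
  then have "x = u ^ (m + n) * weyl_poly (\<Sum>j<l. p j * q j) u"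
    by (simp add: x weyl_poly_sum sum_distrib_left)
  then show "x \<in> (\<lambda>a. u ^ (m + n) * a) ` gen_subalg u"
    unfolding gen_subalg_def by blast
qed

text \<open>Otherwise, \<open>u\<close> being transcendental over K, the monomial of degree m would
  be a multiple of that of degree n > m.\<close>

lemma u_power_notin:
  assumes "m < n"
  shows "u ^ m \<notin> (\<lambda>a. u ^ n * a) ` gen_subalg u"
proof
  assume "u ^ m \<in> (\<lambda>a. u ^ n * a) ` gen_subalg u"
  then obtain p where "u ^ m = u ^ n * weyl_poly p u"
    unfolding gen_subalg_def by blast
  then have "weyl_poly (monom 1 m) u = weyl_poly (monom 1 n * p) u"
    by (simp add: weyl_poly_monom weyl_poly_mult)
  then have "monom 1 m = monom 1 n * p"
    by (simp only: weyl_poly_u_inject)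
  then have "coeff (monom (1 :: 'k) m) m = coeff (monom 1 n * p) m"
    by simp
  then show False
    using assms by (simp add: coeff_monom_mult)
qed

lemma u_power_in: "u ^ n \<in> (\<lambda>a. u ^ n * a) ` gen_subalg u"
  unfolding gen_subalg_def by (rule image_eqI[OF _ rangeI[of _ 1]]) simp

text \<open>Degree at least 1 makes 1 div (deg \<alpha> + 1) vanish, so u lies in I_1: some a
  satisfies \<open>ad u a = u\<close>, and it lies in N(u) but not in C(u).\<close>

lemma nilpotent_type_u:
  assumes "degree \<alpha> \<ge> 1"
  shows "nilpotent_type u"
proof -
  have "u \<notin> range weyl_const"
  proof
    assume "u \<in> range weyl_const"
    then obtain c where "u = weyl_const c"
      by blast
    then have "weyl_poly [:0, 1:] u = weyl_poly [:c:] u"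
      by (simp add: weyl_poly_pCons)
    then show False
      by (simp only: weyl_poly_u_inject) simp
  qed
  moreover have "centralizer u \<noteq> ad_nil u"
  proof
    assume eq: "centralizer u = ad_nil u"
    have "u ^ 1 \<in> ad_ideal u 1"
      using u_power_in[of 1] assms by (simp add: ad_ideal_eq)
    then obtain a where a: "a \<in> ad_ker u 1" "(ad u ^^ 1) a = u ^ 1"
      unfolding ad_ideal_def by (elim imageE) metis
    then have "a \<in> centralizer u"
      unfolding eq ad_nil_def by blast
    then have "(ad u ^^ 1) a = 0"
      by (simp add: centralizer_def)
    with a(2) have "u = 0"
      by (simp only: power_one_right)
    then show False
      using \<open>u \<notin> range weyl_const\<close> by (metis rangeI weyl_const_0)
  qed
  ultimately show ?thesis
    by (simp add: nilpotent_type_def)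
qed

end

section \<open>The ideals for degree d and the negative answer to Dixmier's Problem 5\<close>

theorem theorem1p1:
  fixes \<alpha> :: "'k::field_char_0 poly" and d :: nat and u :: "'k weyl"
  assumes deg: "degree \<alpha> = d" and d: "d \<ge> 1"
    and u: "u = weyl_poly \<alpha> (weyl_Y * weyl_X) * weyl_X"
  shows "centralizer u = gen_subalg u \<and> inj (\<lambda>p. weyl_poly p u)
    \<and> (\<forall>k\<ge>1. ad_ideal u k = (\<lambda>a. u ^ (k - k div (d + 1)) * a) ` gen_subalg u)
    \<and> ad_ideal u 1 = (\<lambda>a. u * a) ` gen_subalg u
    \<and> (\<forall>i\<ge>1. ad_ideal u (i * (d + 1) - 1) = (\<lambda>a. u ^ (i * d) * a) ` gen_subalg u
           \<and> ad_ideal u (i * (d + 1)) = (\<lambda>a. u ^ (i * d) * a) ` gen_subalg u)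
    \<and> (\<forall>i\<ge>1. ideal_mult (ad_ideal u 1) (ad_ideal u (i * (d + 1) - 1))
           \<noteq> ad_ideal u (i * (d + 1)))
    \<and> nilpotent_type u
    \<and> \<not> (\<forall>\<^sub>F n in sequentially.
           ad_ideal u (n + 1) = ideal_mult (ad_ideal u 1) (ad_ideal u n))
    \<and> \<not> dixmier_problem_5 TYPE('k)"
proof -
  interpret skew_element \<alpha> u
    using deg d by unfold_locales (auto intro: u)
  have ideal: "ad_ideal u k = (\<lambda>a. u ^ (k - k div (d + 1)) * a) ` gen_subalg u" for k
    using ad_ideal_eq[of k] deg by simp
  have ideal_1: "ad_ideal u 1 = (\<lambda>a. u ^ 1 * a) ` gen_subalg u"
    using ideal[of 1] d by simp
  \<comment> \<open>Just below the multiple i (d + 1) the quotient is still i - 1, and i (d + 1) - 1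
    - (i - 1) = i d; at the multiple the quotient is i, which gives i d again.\<close>
  have exponent: "i * (d + 1) - 1 - (i * (d + 1) - 1) div (d + 1) = i * d"
      "i * (d + 1) - i * (d + 1) div (d + 1) = i * d" if "i \<ge> 1" for i
  proof -
    obtain j where i: "i = Suc j"
      using \<open>i \<ge> 1\<close> by (cases i) auto
    have "i * (d + 1) - 1 = d + (d + 1) * j"
      by (simp add: i)
    moreover have "(d + (d + 1) * j) div (d + 1) = j"
      by (subst div_mult_self2) simp_all
    ultimately have "i * (d + 1) - 1 - (i * (d + 1) - 1) div (d + 1) = d + (d + 1) * j - j"
      by (simp only:)
    then show "i * (d + 1) - 1 - (i * (d + 1) - 1) div (d + 1) = i * d"
      by (simp add: i algebra_simps)
    have "i * (d + 1) div (d + 1) = i"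
      by (rule nonzero_mult_div_cancel_right) simp
    then show "i * (d + 1) - i * (d + 1) div (d + 1) = i * d"
      by simp
  qed
  have ideal_i: "ad_ideal u (i * (d + 1) - 1) = (\<lambda>a. u ^ (i * d) * a) ` gen_subalg u"
      "ad_ideal u (i * (d + 1)) = (\<lambda>a. u ^ (i * d) * a) ` gen_subalg u" if "i \<ge> 1" for i
    using ideal[of "i * (d + 1) - 1"] ideal[of "i * (d + 1)"] unfolding exponent[OF that] by blast+
  \<comment> \<open>The product lies in u^(i d + 1) K[u], whereas u^(i d) belongs to the ideal of
    index i (d + 1).\<close>
  have neq: "ideal_mult (ad_ideal u 1) (ad_ideal u (i * (d + 1) - 1)) \<noteq> ad_ideal u (i * (d + 1))"
    if "i \<ge> 1" for i
  proof -
    have "ideal_mult (ad_ideal u 1) (ad_ideal u (i * (d + 1) - 1))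
        \<subseteq> (\<lambda>a. u ^ (1 + i * d) * a) ` gen_subalg u"
      unfolding ideal_1 ideal_i[OF that] by (rule ideal_mult_subset) simp_all
    moreover have "u ^ (i * d) \<notin> (\<lambda>a. u ^ (1 + i * d) * a) ` gen_subalg u"
      by (rule u_power_notin) simp
    moreover have "u ^ (i * d) \<in> ad_ideal u (i * (d + 1))"
      unfolding ideal_i[OF that] by (rule u_power_in)
    ultimately show ?thesis
      by blast
  qed
  have not_eventually: "\<not> (\<forall>\<^sub>F n in sequentially.
      ad_ideal u (n + 1) = ideal_mult (ad_ideal u 1) (ad_ideal u n))"
  proof
    assume "\<forall>\<^sub>F n in sequentially. ad_ideal u (n + 1) = ideal_mult (ad_ideal u 1) (ad_ideal u n)"
    then obtain N where N: "\<And>n. n \<ge> N \<Longrightarrow>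
        ad_ideal u (n + 1) = ideal_mult (ad_ideal u 1) (ad_ideal u n)"
      unfolding eventually_sequentially by blast
    \<comment> \<open>Taking i = N + 1 puts the failing index i (d + 1) - 1 past N.\<close>
    have "N \<le> Suc N * (d + 1) - 1" "Suc N * (d + 1) - 1 + 1 = Suc N * (d + 1)"
      by simp_all
    with N[of "Suc N * (d + 1) - 1"] neq[of "Suc N"] show False
      by simp
  qed
  have nilp: "nilpotent_type u"
    using nilpotent_type_u deg d by simp
  have "\<not> dixmier_problem_5 TYPE('k)"
    unfolding dixmier_problem_5_def using nilp not_eventually by blast
  moreover have "inj (\<lambda>p. weyl_poly p u)"
    by (rule injI) (simp add: weyl_poly_u_inject)
  ultimately show ?thesis
    using centralizer_eq nilp not_eventually
    by (intro conjI allI impI ideal ideal_i neq ideal_1[unfolded power_one_right]) assumption+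
qed

end
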